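(* Let $H$ be a complex Hilbert space. Let $f(\lambda):=\sum_{n=0}^\infty\alpha_n\lambda^n$ be a power series with complex coefficients, convergent on the open disk $D(0,R)$, $R>0$, and let $f_a(\lambda):=\sum_{n=0}^\infty|\alpha_n|\lambda^n$. If $A,B\in\mathcal{B}_2(H)$ are normal operators with $A^*B=BA^*$ and $\operatorname{tr}(|A|^2)<R$, $\operatorname{tr}(|B|^2)<R$, then $$\left|\operatorname{tr}\left(f(A^*B)\right)\right|^2\le\operatorname{tr}\left(f_a(|A|^2)\right)\operatorname{tr}\left(f_a(|B|^2)\right).$$
   Context: $D(0,R)=\{z\in\mathbb{C}:|z|<R\}$ if $R<\infty$ and $D(0,R)=\mathbb{C}$ if $R=\infty$. $\mathcal{B}(H)$ is the algebra of bounded linear operators on $H$, and $|A|:=(A^*A)^{1/2}$. $\mathcal{B}_2(H)$ is the set of Hilbert-Schmidt operators, i.e. $A\in\mathcal{B}(H)$ with $\sum_{i\in I}\|Ae_i\|^2<\infty$ for an (equivalently every) orthonormal basis $\{e_i\}_{i\in I}$ of $H$. $\mathcal{B}_1(H)$ is the set of trace class operators, i.e. $A\in\mathcal{B}(H)$ with $\sum_{i\in I}\langle|A|e_i,e_i\rangle<\infty$; the trace is $\operatorname{tr}(A)=\sum_{i\in I}\langle Ae_i,e_i\rangle$ for $A\in\mathcal{B}_1(H)$. For an operator $S$, $f(S):=\sum_{n=0}^\infty\alpha_nS^n$ (with $S^0=1_H$, the identity operator), and similarly for $f_a$.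
   Formalization: If α_0 ≠ 0 and H is infinite-dimensional the three operators are never trace class and the traces are undefined; the claim has content, with all three proved trace class, only if α_0 = 0 or H is finite-dimensional (otherwise undefined traces are read as 0). *)

theory Defs
  imports "HOL-Analysis.Analysis"
begin

text \<open>
  Complex Hilbert spaces are types of class \<open>chilbert_space\<close>. The inner product is linear in its
  first argument. The real scalar multiplication, needed to reuse \<open>real_normed_vector\<close>, is the
  restriction of the complex one. Positive definiteness of the inner product follows from the norm
  axioms and \<open>norm_eq_sqrt_cinner\<close>.
\<close>

class complex_inner = real_normed_vector +
  fixes scaleC :: "complex \<Rightarrow> 'a \<Rightarrow> 'a"  (infixr "*\<^sub>C" 75)
    and cinner :: "'a \<Rightarrow> 'a \<Rightarrow> complex"
  assumes scaleC_of_real: "complex_of_real r *\<^sub>C x = r *\<^sub>R x"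
    and scaleC_add_right: "c *\<^sub>C (x + y) = c *\<^sub>C x + c *\<^sub>C y"
    and scaleC_add_left: "(c + d) *\<^sub>C x = c *\<^sub>C x + d *\<^sub>C x"
    and scaleC_scaleC: "c *\<^sub>C d *\<^sub>C x = (c * d) *\<^sub>C x"
    and cinner_commute: "cinner x y = cnj (cinner y x)"
    and cinner_add_left: "cinner (x + y) z = cinner x z + cinner y z"
    and cinner_scaleC_left: "cinner (c *\<^sub>C x) y = c * cinner x y"
    and norm_eq_sqrt_cinner: "norm x = sqrt (Re (cinner x x))"

class chilbert_space = complex_inner + complete_space

lemma scaleC_one: "1 *\<^sub>C x = (x :: 'a :: complex_inner)"
  using scaleC_of_real[of 1 x] by simp

global_interpretation complex_vector: vector_space "scaleC :: complex \<Rightarrow> 'a \<Rightarrow> 'a :: complex_inner"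
  defines cspan = complex_vector.span
  by unfold_locales
    (simp_all add: scaleC_add_right scaleC_add_left scaleC_scaleC scaleC_one)

lemma norm_scaleC: "norm (c *\<^sub>C x) = cmod c * norm (x :: 'a :: complex_inner)"
proof -
  have "cinner (c *\<^sub>C x) (c *\<^sub>C x) = c * cnj (c * cinner x x)"
    by (metis cinner_commute cinner_scaleC_left)
  also have "\<dots> = complex_of_real ((cmod c)\<^sup>2) * cinner x x"
    by (metis cinner_commute complex_cnj_mult complex_norm_square mult.assoc)
  finally have "Re (cinner (c *\<^sub>C x) (c *\<^sub>C x)) = (cmod c)\<^sup>2 * Re (cinner x x)"
    by simp
  then show ?thesis
    by (simp add: norm_eq_sqrt_cinner real_sqrt_mult)
qed

text \<open>
  Elements of type \<open>'a \<Rightarrow>\<^sub>L 'a\<close> are bounded real-linear maps; the bounded complex-linear operators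
  are those in \<open>bounded_ops\<close>. The norm of \<open>'a \<Rightarrow>\<^sub>L 'a\<close> is the operator norm.
\<close>

definition bounded_ops :: "('a :: complex_inner \<Rightarrow>\<^sub>L 'a) set" where
  "bounded_ops = {A. \<forall>c x. blinfun_apply A (c *\<^sub>C x) = c *\<^sub>C blinfun_apply A x}"

lift_definition scaleC_op :: "complex \<Rightarrow> ('a :: complex_inner \<Rightarrow>\<^sub>L 'a) \<Rightarrow> ('a \<Rightarrow>\<^sub>L 'a)"
  is "\<lambda>c A x. c *\<^sub>C A x"
proof -
  fix c :: complex and A :: "'a \<Rightarrow> 'a"
  assume "bounded_linear A"
  moreover have "bounded_linear (\<lambda>x :: 'a. c *\<^sub>C x)"
  proof (rule bounded_linear_intro[where K = "cmod c"])
    fix r :: real and x :: 'a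
    show "c *\<^sub>C r *\<^sub>R x = r *\<^sub>R c *\<^sub>C x"
      by (simp add: scaleC_of_real[symmetric] scaleC_scaleC mult.commute)
  qed (simp_all add: scaleC_add_right norm_scaleC mult.commute)
  ultimately show "bounded_linear (\<lambda>x. c *\<^sub>C A x)"
    by (rule bounded_linear_compose[rotated])
qed

definition op_power :: "('a :: complex_inner \<Rightarrow>\<^sub>L 'a) \<Rightarrow> nat \<Rightarrow> ('a \<Rightarrow>\<^sub>L 'a)" where
  "op_power A n = ((o\<^sub>L) A ^^ n) id_blinfun"

definition op_series :: "(nat \<Rightarrow> complex) \<Rightarrow> ('a :: complex_inner \<Rightarrow>\<^sub>L 'a) \<Rightarrow> ('a \<Rightarrow>\<^sub>L 'a)" where
  "op_series \<alpha> S = (\<Sum>n. scaleC_op (\<alpha> n) (op_power S n))"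

definition adj :: "('a :: chilbert_space \<Rightarrow>\<^sub>L 'a) \<Rightarrow> ('a \<Rightarrow>\<^sub>L 'a)" where
  "adj A = (THE B. \<forall>x y. cinner (blinfun_apply A x) y = cinner x (blinfun_apply B y))"

definition normal_op :: "('a :: chilbert_space \<Rightarrow>\<^sub>L 'a) \<Rightarrow> bool" where
  "normal_op A \<longleftrightarrow> A \<in> bounded_ops \<and> adj A o\<^sub>L A = A o\<^sub>L adj A"

definition positive_op :: "('a :: chilbert_space \<Rightarrow>\<^sub>L 'a) \<Rightarrow> bool" where
  "positive_op P \<longleftrightarrow>
     P \<in> bounded_ops \<and> (\<forall>x. cinner (blinfun_apply P x) x \<in> \<real> \<and> 0 \<le> Re (cinner (blinfun_apply P x) x))"

definition sqrt_op :: "('a :: chilbert_space \<Rightarrow>\<^sub>L 'a) \<Rightarrow> ('a \<Rightarrow>\<^sub>L 'a)" where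
  "sqrt_op T = (THE P. positive_op P \<and> P o\<^sub>L P = T)"

definition abs_op :: "('a :: chilbert_space \<Rightarrow>\<^sub>L 'a) \<Rightarrow> ('a \<Rightarrow>\<^sub>L 'a)" where
  "abs_op A = sqrt_op (adj A o\<^sub>L A)"

definition is_onb :: "'a :: chilbert_space set \<Rightarrow> bool" where
  "is_onb E \<longleftrightarrow>
     (\<forall>e\<in>E. norm e = 1) \<and> (\<forall>e\<in>E. \<forall>e'\<in>E. e \<noteq> e' \<longrightarrow> cinner e e' = 0) \<and>
     closure (cspan E) = UNIV"

definition hilbert_schmidt :: "('a :: chilbert_space \<Rightarrow>\<^sub>L 'a) set" where
  "hilbert_schmidt =
     {A \<in> bounded_ops. \<exists>E. is_onb E \<and> (\<lambda>e. (norm (blinfun_apply A e))\<^sup>2) summable_on E}"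

definition trace_class :: "('a :: chilbert_space \<Rightarrow>\<^sub>L 'a) set" where
  "trace_class =
     {A \<in> bounded_ops. \<exists>E. is_onb E \<and> (\<lambda>e. cinner (blinfun_apply (abs_op A) e) e) summable_on E}"

text \<open>
  For trace class operators the sum does not depend on the chosen orthonormal basis. For other
  operators the value has no meaning; it is \<open>0\<close> if the family is not summable.
\<close>

definition tr :: "('a :: chilbert_space \<Rightarrow>\<^sub>L 'a) \<Rightarrow> complex" where
  "tr A = (\<Sum>\<^sub>\<infinity>e\<in>(SOME E. is_onb E). cinner (blinfun_apply A e) e)"

definition finite_dim :: "'a :: complex_inner itself \<Rightarrow> bool" where
  "finite_dim _ \<longleftrightarrow> (\<exists>S :: 'a set. finite S \<and> cspan S = UNIV)"

text \<open>The disc \<open>D(0, R)\<close> for an extended real radius; it is all of \<open>\<complex>\<close> if \<open>R = \<infinity>\<close>.\<close>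

definition open_disc :: "ereal \<Rightarrow> complex set" where
  "open_disc R = {z. ereal (cmod z) < R}"

end

theory Submission
  imports Defs
begin

text \<open>
  Since \<open>A\<^sup>* B = B A\<^sup>*\<close>, one has \<open>\<langle>(A\<^sup>* B)\<^sup>n e, e\<rangle> = \<langle>B\<^sup>n e, A\<^sup>n e\<rangle>\<close>, and normality gives
  \<open>\<langle>(A\<^sup>* A)\<^sup>n e, e\<rangle> = \<parallel>A\<^sup>n e\<parallel>\<^sup>2\<close>. The inequality is then Cauchy-Schwarz, applied to the sum over \<open>n\<close> with
  weights \<open>|\<alpha>\<^sub>n|\<close> and to the sum over an orthonormal basis; the right-hand side converges because
  \<open>\<Sum>\<^sub>e \<parallel>A\<^sup>n e\<parallel>\<^sup>2 \<le> (tr |A|\<^sup>2)\<^sup>n\<close> for \<open>n \<ge> 1\<close>. If \<open>\<alpha>\<^sub>0 = 0\<close>, the series factors as \<open>Y A\<^sup>* B\<close> with \<open>Y\<close> bounded,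
  a product of two Hilbert-Schmidt operators and hence trace class.
\<close>

text \<open>Since \<open>adj\<close>, \<open>sqrt_op\<close> and \<open>tr\<close> are defined by
  \<open>THE\<close> and \<open>SOME\<close>, each acquires meaning only through an existence proof,
  for the first two also a uniqueness proof: Riesz representation, an iteration for the square root,
  and Zorn's lemma for bases. Hilbert-Schmidt and trace class are stated for some basis, while
  \<open>tr\<close> fixes one; Hilbert-Schmidt sums are carried between bases by passing to the
  adjoint twice. For the trace class property of a product T, the adjoint of the partial isometry in
  its polar decomposition is replaced by a polynomial in |T| times the adjoint of T; this suffices
  because finite sums of diagonal entries of |T| only have to be bounded. The squared operator norm
  is at most the Hilbert-Schmidt sum, so one real r below R controls the norms and the convergence
  of all three series. The obstacle is the constant term: the identity has no summable diagonal on
  an infinite-dimensional space, so the index n = 0 decides between two different arguments.\<close>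

instance chilbert_space \<subseteq> banach ..

subsection \<open>The inner product\<close>

lemma cinner_add_right: "cinner x (y + z) = cinner x y + cinner x (z :: 'a :: complex_inner)"
  by (metis cinner_add_left cinner_commute complex_cnj_add)

lemma cinner_scaleC_right: "cinner x (c *\<^sub>C y) = cnj c * cinner x (y :: 'a :: complex_inner)"
  by (metis cinner_commute cinner_scaleC_left complex_cnj_mult)

lemma cinner_zero_left [simp]: "cinner 0 (y :: 'a :: complex_inner) = 0"
  using cinner_add_left[of 0 0 y] by simp

lemma cinner_zero_right [simp]: "cinner (x :: 'a :: complex_inner) 0 = 0"
  using cinner_add_right[of x 0 0] by simp

lemma cinner_diff_left: "cinner (x - y) z = cinner x z - cinner y (z :: 'a :: complex_inner)"
  using cinner_add_left[of "x - y" y z] by simp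

lemma cinner_diff_right: "cinner x (y - z) = cinner x y - cinner x (z :: 'a :: complex_inner)"
  using cinner_add_right[of x "y - z" z] by simp

lemma cinner_scaleR_left: "cinner (r *\<^sub>R x) y = r * cinner x (y :: 'a :: complex_inner)"
  by (metis cinner_scaleC_left scaleC_of_real)

lemma cinner_scaleR_right: "cinner x (r *\<^sub>R y) = r * cinner x (y :: 'a :: complex_inner)"
  by (metis cinner_scaleC_right complex_cnj_complex_of_real scaleC_of_real)

lemma cinner_sum_left: "cinner (sum f F) y = (\<Sum>i\<in>F. cinner (f i) (y :: 'a :: complex_inner))"
  by (induction F rule: infinite_finite_induct) (auto simp: cinner_add_left)

lemma cinner_self: "cinner x x = complex_of_real ((norm (x :: 'a :: complex_inner))\<^sup>2)"
proof -
  have "Im (cinner x x) = 0"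
    by (metis cinner_commute complex_cnj_cancel_iff Reals_cnj_iff complex_is_Real_iff)
  moreover have "Re (cinner x x) = (norm x)\<^sup>2"
    by (metis norm_eq_sqrt_cinner norm_ge_zero real_sqrt_ge_0_iff real_sqrt_pow2)
  ultimately show ?thesis by (simp add: complex_eq_iff)
qed

lemma cinner_eqI:
  assumes "\<And>z. cinner z x = cinner z (y :: 'a :: complex_inner)"
  shows "x = y"
proof -
  have "cinner (x - y) (x - y) = 0"
    by (simp add: cinner_diff_right assms)
  then show ?thesis by (simp add: cinner_self)
qed

lemma norm_add_square:
  "(norm (x + y))\<^sup>2 = (norm x)\<^sup>2 + 2 * Re (cinner x y) + (norm (y :: 'a :: complex_inner))\<^sup>2"
proof -
  have "complex_of_real ((norm (x + y))\<^sup>2) = cinner x x + (cinner x y + cnj (cinner x y)) + cinner y y"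
    by (metis (no_types, lifting) cinner_self add.assoc cinner_add_left cinner_add_right cinner_commute)
  then have "Re (complex_of_real ((norm (x + y))\<^sup>2)) =
      Re (cinner x x + (cinner x y + cnj (cinner x y)) + cinner y y)" by simp
  then show ?thesis by (simp add: cinner_self del: of_real_power)
qed

lemma norm_diff_square:
  "(norm (x - y))\<^sup>2 = (norm x)\<^sup>2 - 2 * Re (cinner x y) + (norm (y :: 'a :: complex_inner))\<^sup>2"
  using norm_add_square[of x "- y"] cinner_diff_right[of x 0 y] by simp

text \<open>Pythagoras for the component of x orthogonal to the line through y. Cauchy-Schwarz, the
  minimality argument for projections and the residual formula for orthonormal families all read off
  this computation.\<close>

lemma norm_diff_projection_square:
  assumes "y \<noteq> (0 :: 'a :: complex_inner)"
  shows "(norm (x - (cinner x y / complex_of_real ((norm y)\<^sup>2)) *\<^sub>C y))\<^sup>2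
    = (norm x)\<^sup>2 - (cmod (cinner x y))\<^sup>2 / (norm y)\<^sup>2"
proof -
  define n where "n = (norm y)\<^sup>2"
  have n: "n > 0" using assms by (simp add: n_def)
  define c where "c = cinner x y / complex_of_real n"
  have "cnj c * cinner x y = complex_of_real ((cmod (cinner x y))\<^sup>2 / n)"
    by (simp add: c_def complex_norm_square mult.commute del: of_real_power)
  then have "Re (cinner x (c *\<^sub>C y)) = (cmod (cinner x y))\<^sup>2 / n"
    by (simp add: cinner_scaleC_right)
  moreover have "(norm (c *\<^sub>C y))\<^sup>2 = (cmod (cinner x y))\<^sup>2 / n"
    using n by (simp add: norm_scaleC power_mult_distrib c_def norm_divide power_divide
        flip: n_def) (simp add: power2_eq_square)
  ultimately have "(norm (x - c *\<^sub>C y))\<^sup>2 = (norm x)\<^sup>2 - (cmod (cinner x y))\<^sup>2 / n"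
    by (simp add: norm_diff_square)
  then show ?thesis by (simp add: c_def n_def)
qed

text \<open>The squared residual after projecting x onto y cannot be negative.\<close>

lemma norm_cinner_le: "cmod (cinner x y) \<le> norm x * norm (y :: 'a :: complex_inner)"
proof (cases "y = 0")
  case False
  have "(cmod (cinner x y))\<^sup>2 / (norm y)\<^sup>2 \<le> (norm x)\<^sup>2"
    using norm_diff_projection_square[OF False, of x]
    by (metis diff_ge_0_iff_ge zero_le_power2)
  then have "(cmod (cinner x y))\<^sup>2 \<le> (norm x * norm y)\<^sup>2"
    using False by (simp add: divide_le_eq power_mult_distrib)
  then show ?thesis by (simp add: power2_le_iff_abs_le)
qed simp

lemma bounded_bilinear_cinner:
  "bounded_bilinear (cinner :: 'a :: complex_inner \<Rightarrow> 'a \<Rightarrow> complex)"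
proof
  show "\<exists>K. \<forall>a b :: 'a. norm (cinner a b) \<le> norm a * norm b * K"
    by (rule exI[of _ 1]) (simp add: norm_cinner_le)
qed (simp_all add: cinner_add_left cinner_add_right cinner_scaleR_left cinner_scaleR_right
    scaleR_conv_of_real)

lemmas bounded_linear_cinner_left = bounded_bilinear.bounded_linear_left[OF bounded_bilinear_cinner]
lemmas tendsto_cinner = bounded_bilinear.tendsto[OF bounded_bilinear_cinner]

lemma bounded_linear_scaleC: "bounded_linear (\<lambda>x :: 'a :: complex_inner. c *\<^sub>C x)"
proof (rule bounded_linear_intro[where K = "cmod c"])
  fix r :: real and x :: 'a
  show "c *\<^sub>C r *\<^sub>R x = r *\<^sub>R c *\<^sub>C x"
    by (simp add: scaleC_of_real[symmetric] scaleC_scaleC mult.commute)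
qed (simp_all add: scaleC_add_right norm_scaleC mult.commute)

subsection \<open>Orthogonal projection, Riesz representation and adjoints\<close>

text \<open>A sequence in M realising the distance from x is Cauchy by the parallelogram law, and
  completeness gives a nearest point m. If x - m were not orthogonal to some y in M, moving m along
  y would bring it closer to x.\<close>

lemma orthogonal_projection_exists:
  fixes M :: "'a :: chilbert_space set"
  assumes sub: "complex_vector.subspace M" and cl: "closed M"
  obtains m where "m \<in> M" and "\<And>y. y \<in> M \<Longrightarrow> cinner (x - m) y = 0"
proof -
  note add = complex_vector.subspace_add[OF sub] and scale = complex_vector.subspace_scale[OF sub]
  have ne: "M \<noteq> {}" using complex_vector.subspace_0[OF sub] by auto
  define d where "d = infdist x M"
  have d0: "d \<ge> 0" by (simp add: d_def infdist_nonneg)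
  have dle: "d \<le> norm (x - y)" if "y \<in> M" for y
    using infdist_le[OF that, of x] by (simp add: d_def dist_norm)
  have "\<exists>y\<in>M. norm (x - y) < d + 1 / real (Suc n)" for n
  proof (rule ccontr)
    assume "\<not> ?thesis"
    then have "d + 1 / real (Suc n) \<le> infdist x M"
      unfolding infdist_notempty[OF ne] by (intro cINF_greatest ne) (auto simp: dist_norm not_less)
    then show False by (simp add: d_def field_simps)
  qed
  then obtain s where s: "\<And>n. s n \<in> M" and sd: "\<And>n. norm (x - s n) < d + 1 / real (Suc n)"
    by metis
  define u where "u = (\<lambda>n. (norm (x - s n))\<^sup>2)"
  have "(\<lambda>n. norm (x - s n)) \<longlonglongrightarrow> d"
  proof (rule tendsto_sandwich[where f = "\<lambda>_. d"])
    show "(\<lambda>n. d + 1 / real (Suc n)) \<longlonglongrightarrow> d"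
      using tendsto_add[OF tendsto_const[of d] LIMSEQ_inverse_real_of_nat]
      by (simp add: inverse_eq_divide)
    show "\<forall>\<^sub>F n in sequentially. norm (x - s n) \<le> d + 1 / real (Suc n)"
      using sd by (simp add: less_imp_le)
  qed (use dle s in auto)
  then have lim: "(\<lambda>n. norm (x - s n)) \<longlonglongrightarrow> d" and ud: "u \<longlonglongrightarrow> d\<^sup>2"
    unfolding u_def by (auto intro: tendsto_power)
  have par: "(norm (s i - s j))\<^sup>2 \<le> 2 * (u i - d\<^sup>2) + 2 * (u j - d\<^sup>2)" for i j
  proof -
    \<comment> \<open>The midpoint of two terms lies in M, hence is no closer to x than d; two
      nearly optimal points must therefore be close to each other.\<close>
    define m where "m = complex_of_real (1/2) *\<^sub>C (s i + s j)"
    have "m \<in> M" unfolding m_def by (intro scale add s)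
    then have "d\<^sup>2 \<le> (norm (x - m))\<^sup>2" using dle d0 by (intro power_mono) auto
    moreover have "(x - s i) + (x - s j) = 2 *\<^sub>R (x - m)"
      unfolding m_def scaleC_of_real by (simp add: algebra_simps scaleR_2)
    then have "(norm ((x - s i) + (x - s j)))\<^sup>2 = 4 * (norm (x - m))\<^sup>2"
      by (simp add: power_mult_distrib)
    moreover have "(norm (s i - s j))\<^sup>2 = (norm ((x - s j) - (x - s i)))\<^sup>2" by simp
    moreover have "cnj (cinner (x - s i) (x - s j)) = cinner (x - s j) (x - s i)"
      by (metis cinner_commute)
    then have "Re (cinner (x - s j) (x - s i)) = Re (cinner (x - s i) (x - s j))"
      by (metis complex_cnj cnj.simps(1))
    ultimately show ?thesis
      unfolding norm_add_square norm_diff_square[of "x - s j" "x - s i"] u_def by argo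
  qed
  have "Cauchy s"
  proof (rule CauchyI)
    fix e :: real assume e: "e > 0"
    then have "\<forall>\<^sub>F n in sequentially. u n < d\<^sup>2 + e\<^sup>2 / 4"
      by (intro order_tendstoD(2)[OF ud]) auto
    then obtain N where N: "\<And>n. n \<ge> N \<Longrightarrow> u n < d\<^sup>2 + e\<^sup>2 / 4"
      by (auto simp: eventually_sequentially)
    have "norm (s i - s j) < e" if "i \<ge> N" "j \<ge> N" for i j
    proof -
      have "(norm (s i - s j))\<^sup>2 < e\<^sup>2" using par[of i j] N[of i] N[of j] that by simp
      then show ?thesis using e by (simp add: power2_less_imp_less)
    qed
    then show "\<exists>N. \<forall>i\<ge>N. \<forall>j\<ge>N. norm (s i - s j) < e" by blast
  qed
  then obtain m where m: "s \<longlonglongrightarrow> m" by (auto simp: Cauchy_convergent_iff convergent_def)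
  have mM: "m \<in> M" using closed_sequentially[OF cl _ m] s by blast
  have "(\<lambda>n. norm (x - s n)) \<longlonglongrightarrow> norm (x - m)" by (intro tendsto_intros m)
  then have nd: "norm (x - m) = d" using lim LIMSEQ_unique by blast
  have "cinner (x - m) y = 0" if y: "y \<in> M" for y
  proof (cases "y = 0")
    case False
    \<comment> \<open>The step along y that decreases the distance most.\<close>
    define c where "c = cinner (x - m) y / complex_of_real ((norm y)\<^sup>2)"
    have "d\<^sup>2 \<le> (norm (x - (m + c *\<^sub>C y)))\<^sup>2"
      using y mM d0 by (intro power_mono dle add scale)
    also have "x - (m + c *\<^sub>C y) = (x - m) - c *\<^sub>C y" by simp
    also have "(norm ((x - m) - c *\<^sub>C y))\<^sup>2 = d\<^sup>2 - (cmod (cinner (x - m) y))\<^sup>2 / (norm y)\<^sup>2"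
      unfolding c_def norm_diff_projection_square[OF False] nd ..
    finally have "(cmod (cinner (x - m) y))\<^sup>2 / (norm y)\<^sup>2 \<le> 0" by simp
    then show ?thesis using False by (simp add: divide_le_0_iff)
  qed simp
  then show ?thesis using mM that by blast
qed

text \<open>Up to the kernel, a closed subspace, a single direction is left: that of w, the
  component of x orthogonal to the kernel. Every y is a multiple of w plus a kernel element, so
  pairing with w determines the functional.\<close>

lemma riesz_representation:
  fixes \<phi> :: "'a :: chilbert_space \<Rightarrow> complex"
  assumes bl: "bounded_linear \<phi>" and sc: "\<And>c x. \<phi> (c *\<^sub>C x) = c * \<phi> x"
  obtains z where "\<And>x. \<phi> x = cinner x z"
proof (cases "\<forall>x. \<phi> x = 0")
  case True
  then show ?thesis using that[of 0] by simp
next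
  case False
  then obtain x where x: "\<phi> x \<noteq> 0" by blast
  interpret bounded_linear \<phi> by fact
  let ?M = "{x. \<phi> x = 0}"
  have "complex_vector.subspace ?M"
    by (auto simp: complex_vector.subspace_def add sc zero)
  moreover have "closed ?M"
    by (intro closed_Collect_eq continuous_intros linear_continuous_on bl)
  ultimately obtain m where m: "\<phi> m = 0" and orth: "\<And>y. \<phi> y = 0 \<Longrightarrow> cinner (x - m) y = 0"
    using orthogonal_projection_exists[of ?M x] by auto
  define w where "w = x - m"
  have w: "\<phi> w \<noteq> 0" using m x by (simp add: w_def diff)
  then have w0: "w \<noteq> 0" using zero by auto
  \<comment> \<open>The conjugate compensates for conjugate linearity in the second
    argument.\<close>
  have "\<phi> y = cinner y ((cnj (\<phi> w) / complex_of_real ((norm w)\<^sup>2)) *\<^sub>C w)" for y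
  proof -
    have "\<phi> (y - (\<phi> y / \<phi> w) *\<^sub>C w) = 0" using w by (simp add: diff sc)
    then have "cinner w (y - (\<phi> y / \<phi> w) *\<^sub>C w) = 0" using orth by (simp add: w_def)
    then have "cinner (y - (\<phi> y / \<phi> w) *\<^sub>C w) w = 0" using cinner_commute complex_cnj_zero by metis
    then have "cinner y w = \<phi> y / \<phi> w * complex_of_real ((norm w)\<^sup>2)"
      by (simp add: cinner_diff_left cinner_scaleC_left cinner_self)
    then show ?thesis using w w0 by (simp add: cinner_scaleC_right)
  qed
  then show ?thesis by (rule that)
qed

lemma bounded_opsD: "A \<in> bounded_ops \<Longrightarrow> blinfun_apply A (c *\<^sub>C x) = c *\<^sub>C blinfun_apply A x"
  by (simp add: bounded_ops_def)

lemma adj_equality: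
  fixes A B :: "'a :: chilbert_space \<Rightarrow>\<^sub>L 'a"
  assumes "\<And>x y. cinner (blinfun_apply A x) y = cinner x (blinfun_apply B y)"
  shows "adj A = B"
  unfolding adj_def
proof (rule the_equality)
  fix B' assume "\<forall>x y. cinner (blinfun_apply A x) y = cinner x (blinfun_apply B' y)"
  then have "blinfun_apply B' y = blinfun_apply B y" for y
    by (intro cinner_eqI) (metis assms)
  then show "B' = B" by (simp add: blinfun_eqI)
qed (use assms in blast)

text \<open>Riesz representation gives a value for each y separately. The description in
  \<open>adj\<close> ranges over bounded maps, so these values must be shown to form one; the bound
  is (norm (g x))^2 = |<A (g x), x>| with one factor norm (g x) cancelled.\<close>

lemma cinner_adj:
  fixes A :: "'a :: chilbert_space \<Rightarrow>\<^sub>L 'a"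
  assumes A: "A \<in> bounded_ops"
  shows "cinner (blinfun_apply A x) y = cinner x (blinfun_apply (adj A) y)"
proof -
  have "\<exists>z. \<forall>x. cinner (blinfun_apply A x) y = cinner x z" for y
  proof -
    have "bounded_linear (\<lambda>x. cinner (blinfun_apply A x) y)"
      by (rule bounded_linear_compose[OF bounded_linear_cinner_left blinfun.bounded_linear_right])
    then show ?thesis
      using riesz_representation[of "\<lambda>x. cinner (blinfun_apply A x) y"]
      by (metis (no_types, lifting) A bounded_opsD cinner_scaleC_left)
  qed
  then obtain g where g: "\<And>x y. cinner (blinfun_apply A x) y = cinner x (g y)" by metis
  have "bounded_linear g"
  proof (rule bounded_linear_intro[where K = "norm A"])
    fix x y r
    show "g (x + y) = g x + g y"
      by (rule cinner_eqI) (simp add: cinner_add_right flip: g)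
    show "g (r *\<^sub>R x) = r *\<^sub>R g x"
      by (rule cinner_eqI) (simp add: cinner_scaleR_right flip: g)
    have "(norm (g x))\<^sup>2 = cmod (cinner (blinfun_apply A (g x)) x)"
      by (simp add: g cinner_self norm_power)
    also have "\<dots> \<le> norm (blinfun_apply A (g x)) * norm x" by (rule norm_cinner_le)
    also have "\<dots> \<le> norm A * norm (g x) * norm x"
      by (intro mult_right_mono norm_blinfun) auto
    finally show "norm (g x) \<le> norm x * norm A"
      by (cases "g x = 0") (auto simp: power2_eq_square mult_ac)
  qed
  then have "adj A = Blinfun g" and "blinfun_apply (Blinfun g) = g"
    using g by (auto intro!: adj_equality simp: bounded_linear_Blinfun_apply)
  then show ?thesis by (simp add: g)
qed

lemma cinner_adj':
  fixes A :: "'a :: chilbert_space \<Rightarrow>\<^sub>L 'a"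
  assumes A: "A \<in> bounded_ops"
  shows "cinner (blinfun_apply (adj A) x) y = cinner x (blinfun_apply A y)"
  by (metis cinner_commute cinner_adj[OF A])

lemma bounded_ops_id [simp]: "id_blinfun \<in> bounded_ops"
  by (simp add: bounded_ops_def)

lemma bounded_ops_compose [simp]:
  "A \<in> bounded_ops \<Longrightarrow> B \<in> bounded_ops \<Longrightarrow> A o\<^sub>L B \<in> bounded_ops"
  by (simp add: bounded_ops_def)

lemma bounded_ops_add [simp]:
  "A \<in> bounded_ops \<Longrightarrow> B \<in> bounded_ops \<Longrightarrow> A + B \<in> bounded_ops"
  by (simp add: bounded_ops_def blinfun.add_left scaleC_add_right)

lemma bounded_ops_diff [simp]:
  "A \<in> bounded_ops \<Longrightarrow> B \<in> bounded_ops \<Longrightarrow> A - B \<in> bounded_ops"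
  by (simp add: bounded_ops_def blinfun.diff_left complex_vector.scale_right_diff_distrib)

lemma bounded_ops_zero [simp]: "0 \<in> bounded_ops"
  by (simp add: bounded_ops_def)

lemma bounded_ops_scaleC_op [simp]: "A \<in> bounded_ops \<Longrightarrow> scaleC_op c A \<in> bounded_ops"
  by (simp add: bounded_ops_def scaleC_op.rep_eq scaleC_scaleC mult.commute)

lemma bounded_ops_scaleR [simp]: "A \<in> bounded_ops \<Longrightarrow> r *\<^sub>R A \<in> bounded_ops"
  by (simp add: bounded_ops_def blinfun.scaleR_left scaleC_scaleC mult.commute flip: scaleC_of_real)

lemma bounded_ops_sum [simp]:
  "(\<And>i. i \<in> I \<Longrightarrow> A i \<in> bounded_ops) \<Longrightarrow> sum A I \<in> bounded_ops"
  by (induction I rule: infinite_finite_induct) auto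

text \<open>Elements of the function type are only real-linear, so complex linearity of limits needs
  its own argument. Both the square root and the power series arise as limits.\<close>

lemma bounded_ops_limit:
  assumes "\<And>n. A n \<in> bounded_ops" and lim: "A \<longlonglongrightarrow> L"
  shows "L \<in> bounded_ops"
  unfolding bounded_ops_def
proof clarify
  fix c x
  have lim': "(\<lambda>n. blinfun_apply (A n) y) \<longlonglongrightarrow> blinfun_apply L y" for y
    by (intro blinfun.tendsto lim tendsto_const)
  have "(\<lambda>n. c *\<^sub>C blinfun_apply (A n) x) \<longlonglongrightarrow> c *\<^sub>C blinfun_apply L x"
    by (rule bounded_linear.tendsto[OF bounded_linear_scaleC lim'])
  then show "blinfun_apply L (c *\<^sub>C x) = c *\<^sub>C blinfun_apply L x"
    using lim'[of "c *\<^sub>C x"] assms(1) LIMSEQ_unique by (simp add: bounded_opsD)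
qed

lemma bounded_ops_adj [simp]:
  fixes A :: "'a :: chilbert_space \<Rightarrow>\<^sub>L 'a"
  assumes "A \<in> bounded_ops"
  shows "adj A \<in> bounded_ops"
  unfolding bounded_ops_def
proof clarify
  fix c x
  show "blinfun_apply (adj A) (c *\<^sub>C x) = c *\<^sub>C blinfun_apply (adj A) x"
    by (rule cinner_eqI) (simp add: cinner_scaleC_right flip: cinner_adj[OF assms])
qed

lemma adj_adj [simp]:
  fixes A :: "'a :: chilbert_space \<Rightarrow>\<^sub>L 'a"
  shows "A \<in> bounded_ops \<Longrightarrow> adj (adj A) = A"
  by (rule adj_equality) (rule cinner_adj')

lemma cinner_adj_compose_self:
  fixes A :: "'a :: chilbert_space \<Rightarrow>\<^sub>L 'a"
  assumes A: "A \<in> bounded_ops"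
  shows "cinner (blinfun_apply (adj A o\<^sub>L A) x) x = complex_of_real ((norm (blinfun_apply A x))\<^sup>2)"
  by (simp add: cinner_adj'[OF A] cinner_self)

lemma norm_adj_le:
  fixes A :: "'a :: chilbert_space \<Rightarrow>\<^sub>L 'a"
  assumes A: "A \<in> bounded_ops"
  shows "norm (adj A) \<le> norm A"
proof (rule norm_blinfun_bound)
  fix x
  let ?y = "blinfun_apply (adj A) x"
  have "(norm ?y)\<^sup>2 = cmod (cinner (blinfun_apply A ?y) x)"
    by (simp add: cinner_adj[OF A] cinner_self norm_power)
  also have "\<dots> \<le> norm (blinfun_apply A ?y) * norm x" by (rule norm_cinner_le)
  also have "\<dots> \<le> norm A * norm ?y * norm x"
    by (intro mult_right_mono norm_blinfun) auto
  finally show "norm ?y \<le> norm A * norm x"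
    by (cases "?y = 0") (auto simp: power2_eq_square mult_ac)
qed simp

lemma norm_adj [simp]:
  fixes A :: "'a :: chilbert_space \<Rightarrow>\<^sub>L 'a"
  assumes "A \<in> bounded_ops"
  shows "norm (adj A) = norm A"
  using norm_adj_le[OF assms] norm_adj_le[OF bounded_ops_adj[OF assms]] assms by simp

subsection \<open>Orthonormal bases\<close>

text \<open>The part of \<open>is_onb\<close> that passes to subsets, so that it applies to finite
  pieces of a basis.\<close>

definition orthonormal :: "'a :: complex_inner set \<Rightarrow> bool" where
  "orthonormal E \<longleftrightarrow> (\<forall>e\<in>E. norm e = 1) \<and> (\<forall>e\<in>E. \<forall>e'\<in>E. e \<noteq> e' \<longrightarrow> cinner e e' = 0)"

lemma is_onb_iff: "is_onb E \<longleftrightarrow> orthonormal E \<and> closure (cspan E) = UNIV"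
  by (simp add: is_onb_def orthonormal_def)

lemma orthonormal_subset: "orthonormal E \<Longrightarrow> F \<subseteq> E \<Longrightarrow> orthonormal F"
  unfolding orthonormal_def by (meson subsetD)

lemma cinner_span_eq_0:
  fixes x :: "'a :: complex_inner"
  assumes "\<And>e. e \<in> E \<Longrightarrow> cinner x e = 0" and "y \<in> cspan E"
  shows "cinner x y = 0"
proof -
  have "complex_vector.subspace {y. cinner x y = 0}"
    by (auto simp: complex_vector.subspace_def cinner_add_right cinner_scaleC_right)
  then show ?thesis
    using complex_vector.span_minimal[of E "{y. cinner x y = 0}"] assms by blast
qed

text \<open>One vector is projected out at a time: the new e is orthogonal to the earlier ones, so
  its coefficient in the current residual is the one in x.\<close>

lemma orthonormal_residual:
  fixes x :: "'a :: complex_inner"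
  assumes "finite F" and "orthonormal F"
  shows "(norm (x - (\<Sum>e\<in>F. cinner x e *\<^sub>C e)))\<^sup>2 = (norm x)\<^sup>2 - (\<Sum>e\<in>F. (cmod (cinner x e))\<^sup>2)"
  using assms
proof (induction F rule: finite_induct)
  case (insert e F)
  define y where "y = x - (\<Sum>e\<in>F. cinner x e *\<^sub>C e)"
  have e: "norm e = 1" and orth: "\<And>f. f \<in> F \<Longrightarrow> cinner f e = 0"
    using insert.prems insert.hyps unfolding orthonormal_def by auto
  then have "cinner y e = cinner x e"
    by (simp add: y_def cinner_diff_left cinner_sum_left cinner_scaleC_left)
  moreover have "orthonormal F" using insert.prems orthonormal_subset by blast
  moreover have eq: "x - (\<Sum>e\<in>insert e F. cinner x e *\<^sub>C e) = y - cinner x e *\<^sub>C e"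
    using insert.hyps by (simp add: y_def)
  moreover have "e \<noteq> 0" using e by auto
  ultimately show ?case
    unfolding eq using norm_diff_projection_square[of e y] e insert.IH insert.hyps y_def by simp
qed simp

lemma bessel_finite:
  fixes x :: "'a :: complex_inner"
  assumes "finite F" and "orthonormal F"
  shows "(\<Sum>e\<in>F. (cmod (cinner x e))\<^sup>2) \<le> (norm x)\<^sup>2"
  using orthonormal_residual[OF assms, of x]
    zero_le_power2[of "norm (x - (\<Sum>e\<in>F. cinner x e *\<^sub>C e))"] by linarith

lemma orthonormal_best_approximation:
  fixes x :: "'a :: complex_inner"
  assumes F: "finite F" "orthonormal F" and y: "y \<in> cspan F"
  shows "norm (x - (\<Sum>e\<in>F. cinner x e *\<^sub>C e)) \<le> norm (x - y)"
proof -
  define s where "s = (\<Sum>e\<in>F. cinner x e *\<^sub>C e)"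
  have "cinner (x - s) f = 0" if "f \<in> F" for f
  proof -
    have "cinner s f = (\<Sum>e\<in>F. if e = f then cinner x f else 0)"
      unfolding s_def cinner_sum_left
      using F that by (intro sum.cong) (auto simp: cinner_scaleC_left orthonormal_def cinner_self)
    then show ?thesis using F that by (simp add: cinner_diff_left)
  qed
  moreover have "s - y \<in> cspan F"
    unfolding s_def using y
    by (intro complex_vector.span_diff complex_vector.span_sum complex_vector.span_scale)
      (auto intro: complex_vector.span_base)
  ultimately have "cinner (x - s) (s - y) = 0" by (rule cinner_span_eq_0)
  then have "(norm (x - y))\<^sup>2 = (norm (x - s))\<^sup>2 + (norm (s - y))\<^sup>2"
    using norm_add_square[of "x - s" "s - y"] by simp
  then have "(norm (x - s))\<^sup>2 \<le> (norm (x - y))\<^sup>2" by simp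
  then show ?thesis unfolding s_def by (rule power2_le_imp_le) simp
qed

text \<open>Bessel's inequality gives one direction. For the other, a finite combination close to x
  is no better an approximation than the projection onto the span of the same vectors, whose error
  is the missing part of the sum.\<close>

lemma parseval:
  fixes x :: "'a :: chilbert_space"
  assumes E: "is_onb E"
  shows "((\<lambda>e. (cmod (cinner x e))\<^sup>2) has_sum (norm x)\<^sup>2) E"
proof -
  let ?f = "\<lambda>e. (cmod (cinner x e))\<^sup>2"
  have on: "orthonormal E" and dense: "closure (cspan E) = UNIV" using E by (auto simp: is_onb_iff)
  have bes: "sum ?f F \<le> (norm x)\<^sup>2" if "finite F" "F \<subseteq> E" for F
    using bessel_finite orthonormal_subset[OF on] that by blast
  have sm: "?f summable_on E"
    using bes by (intro nonneg_bdd_above_summable_on bdd_aboveI2[where M = "(norm x)\<^sup>2"]) auto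
  have "(norm x)\<^sup>2 \<le> infsum ?f E"
  proof (rule field_le_epsilon)
    fix d :: real assume d: "d > 0"
    have "x \<in> closure (cspan E)" and "sqrt d > 0" using dense d by auto
    then obtain y where y: "y \<in> cspan E" and xy: "dist y x < sqrt d"
      unfolding closure_approachable by blast
    obtain F r where F: "finite F" "F \<subseteq> E" and yF: "y = (\<Sum>a\<in>F. r a *\<^sub>C a)"
      using y unfolding complex_vector.span_explicit by blast
    have yspan: "y \<in> cspan F"
      unfolding yF by (intro complex_vector.span_sum complex_vector.span_scale complex_vector.span_base)
    have "(norm (x - (\<Sum>e\<in>F. cinner x e *\<^sub>C e)))\<^sup>2 \<le> (norm (x - y))\<^sup>2"
      using orthonormal_best_approximation[OF F(1) orthonormal_subset[OF on F(2)] yspan, of x]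
      by (intro power_mono) auto
    also have "\<dots> \<le> (sqrt d)\<^sup>2"
      using xy by (intro power_mono) (auto simp: dist_norm norm_minus_commute)
    finally have "(norm x)\<^sup>2 - sum ?f F \<le> d"
      using orthonormal_residual[OF F(1) orthonormal_subset[OF on F(2)], of x] d by simp
    moreover have "sum ?f F \<le> infsum ?f E"
      by (rule finite_sum_le_infsum[OF sm F(1,2)]) auto
    ultimately show "(norm x)\<^sup>2 \<le> infsum ?f E + d" by linarith
  qed
  moreover have "infsum ?f E \<le> (norm x)\<^sup>2"
    by (rule infsum_le_finite_sums[OF sm bes])
  ultimately show ?thesis using has_sum_infsum[OF sm] by (simp add: order_antisym)
qed

lemma subspace_closure:
  fixes M :: "'a :: complex_inner set"
  assumes M: "complex_vector.subspace M"
  shows "complex_vector.subspace (closure M)"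
  unfolding complex_vector.subspace_def
proof (intro conjI ballI allI)
  show "0 \<in> closure M" using complex_vector.subspace_0[OF M] closure_subset by blast
next
  fix x y assume "x \<in> closure M" "y \<in> closure M"
  then obtain f g where "\<And>n. f n \<in> M" "f \<longlonglongrightarrow> x" "\<And>n. g n \<in> M" "g \<longlonglongrightarrow> y"
    unfolding closure_sequential by blast
  then show "x + y \<in> closure M"
    unfolding closure_sequential
    by (intro exI[of _ "\<lambda>n. f n + g n"]) (auto intro: tendsto_add complex_vector.subspace_add[OF M])
next
  fix c x assume "x \<in> closure M"
  then obtain f where "\<And>n. f n \<in> M" "f \<longlonglongrightarrow> x"
    unfolding closure_sequential by blast
  then show "c *\<^sub>C x \<in> closure M"
    unfolding closure_sequential
    by (intro exI[of _ "\<lambda>n. c *\<^sub>C f n"])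
      (auto intro: bounded_linear.tendsto[OF bounded_linear_scaleC] complex_vector.subspace_scale[OF M])
qed

text \<open>A maximal orthonormal set is total: a vector outside the closed span would, after
  subtracting its projection and normalising, extend the set.\<close>

lemma onb_exists: "\<exists>E :: 'a :: chilbert_space set. is_onb E"
proof -
  have "\<exists>E\<in>{E :: 'a set. orthonormal E}. \<forall>X\<in>{E. orthonormal E}. E \<subseteq> X \<longrightarrow> X = E"
  proof (rule subset_Zorn_nonempty)
    show "{E :: 'a set. orthonormal E} \<noteq> {}" by (auto simp: orthonormal_def)
    fix C :: "'a set set" assume C: "C \<noteq> {}" "subset.chain {E. orthonormal E} C"
    \<comment> \<open>Orthonormality is a condition on pairs, and in a chain any two elements of the
      union lie in one member.\<close>
    have "\<exists>X\<in>C. e \<in> X \<and> e' \<in> X" if "e \<in> \<Union>C" "e' \<in> \<Union>C" for e e'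
      using that C(2) unfolding subset.chain_def by blast
    moreover have "\<And>X. X \<in> C \<Longrightarrow> orthonormal X" using C(2) by (auto simp: subset.chain_def)
    ultimately have "orthonormal (\<Union>C)" unfolding orthonormal_def by (meson)
    then show "\<Union>C \<in> {E. orthonormal E}" by simp
  qed
  then obtain E :: "'a set" where on: "orthonormal E"
    and mx: "\<And>X. orthonormal X \<Longrightarrow> E \<subseteq> X \<Longrightarrow> X = E"
    by blast
  have "x \<in> closure (cspan E)" for x
  proof (rule ccontr)
    assume x: "x \<notin> closure (cspan E)"
    obtain m where m: "m \<in> closure (cspan E)"
      and orth: "\<And>y. y \<in> closure (cspan E) \<Longrightarrow> cinner (x - m) y = 0"
      using orthogonal_projection_exists[OF subspace_closure[OF complex_vector.subspace_span] closed_closure]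
      by blast
    define w where "w = x - m"
    have w0: "norm w \<noteq> 0" using x m by (auto simp: w_def)
    define e where "e = (1 / norm w) *\<^sub>R w"
    have ee: "norm e = 1" using w0 by (simp add: e_def)
    have EM: "E \<subseteq> closure (cspan E)"
      using complex_vector.span_superset closure_subset by blast
    then have eE: "cinner e f = 0" if "f \<in> E" for f
      using orth that by (auto simp: e_def w_def cinner_scaleR_left)
    then have "cinner f e = 0" if "f \<in> E" for f
      using that by (metis cinner_commute complex_cnj_zero)
    then have "orthonormal (insert e E)"
      using on ee eE unfolding orthonormal_def by auto
    then have "e \<in> E" using mx[of "insert e E"] by auto
    then show False using eE ee cinner_self[of e] by simp
  qed
  then show ?thesis using on by (auto simp: is_onb_iff)
qed

text \<open>Orthonormal vectors are linearly independent, so their number is bounded by that of a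
  finite spanning set.\<close>

lemma finite_onb:
  fixes E :: "'a :: chilbert_space set"
  assumes "finite_dim TYPE('a)" and "orthonormal E"
  shows "finite E"
proof -
  have "complex_vector.independent E"
    unfolding complex_vector.dependent_def
  proof clarify
    fix e assume e: "e \<in> E" "e \<in> cspan (E - {e})"
    have "cinner e e = 0"
      by (rule cinner_span_eq_0[OF _ e(2)]) (use e assms(2) in \<open>auto simp: orthonormal_def\<close>)
    then show False using e assms(2) by (auto simp: orthonormal_def cinner_self)
  qed
  then show ?thesis
    using assms(1) complex_vector.independent_span_bound unfolding finite_dim_def by blast
qed

subsection \<open>Hilbert-Schmidt sums\<close>

lemma has_sum_sum:
  fixes f :: "'i \<Rightarrow> 'e \<Rightarrow> 'c :: topological_comm_monoid_add"
  assumes "\<And>i. i \<in> I \<Longrightarrow> (f i has_sum s i) E"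
  shows "((\<lambda>e. \<Sum>i\<in>I. f i e) has_sum sum s I) E"
  using assms by (induction I rule: infinite_finite_induct) (auto intro: has_sum_add)

text \<open>Parseval in E expands each term on the left; after exchanging the sums, Bessel for F
  bounds the contribution of each e. As F is unrelated to E, this is where a change of basis
  happens.\<close>

lemma sum_norm_adj_le:
  fixes A :: "'a :: chilbert_space \<Rightarrow>\<^sub>L 'a"
  assumes A: "A \<in> bounded_ops" and E: "is_onb E"
    and sm: "(\<lambda>e. (norm (blinfun_apply A e))\<^sup>2) summable_on E"
    and F: "finite F" "orthonormal F"
  shows "(\<Sum>f\<in>F. (norm (blinfun_apply (adj A) f))\<^sup>2) \<le> (\<Sum>\<^sub>\<infinity>e\<in>E. (norm (blinfun_apply A e))\<^sup>2)"
proof -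
  have "((\<lambda>e. \<Sum>f\<in>F. (cmod (cinner (blinfun_apply (adj A) f) e))\<^sup>2) has_sum
      (\<Sum>f\<in>F. (norm (blinfun_apply (adj A) f))\<^sup>2)) E"
    by (intro has_sum_sum parseval E)
  moreover have "(\<Sum>f\<in>F. (cmod (cinner (blinfun_apply (adj A) f) e))\<^sup>2) \<le> (norm (blinfun_apply A e))\<^sup>2" for e
  proof -
    have "cmod (cinner (blinfun_apply (adj A) f) e) = cmod (cinner (blinfun_apply A e) f)" for f
      by (metis A cinner_adj' cinner_commute complex_mod_cnj)
    then show ?thesis using bessel_finite[OF F, of "blinfun_apply A e"] by simp
  qed
  ultimately show ?thesis
    by (rule has_sum_mono[OF _ has_sum_infsum[OF sm]])
qed

lemma hilbert_schmidt_adj: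
  fixes A :: "'a :: chilbert_space \<Rightarrow>\<^sub>L 'a"
  assumes A: "A \<in> hilbert_schmidt"
  shows "adj A \<in> hilbert_schmidt"
    and "is_onb E \<Longrightarrow> (\<lambda>e. (norm (blinfun_apply (adj A) e))\<^sup>2) summable_on E"
proof -
  obtain E0 where bA: "A \<in> bounded_ops" and E0: "is_onb E0"
    and sm: "(\<lambda>e. (norm (blinfun_apply A e))\<^sup>2) summable_on E0"
    using A unfolding hilbert_schmidt_def by blast
  have *: "(\<lambda>e. (norm (blinfun_apply (adj A) e))\<^sup>2) summable_on E" if "is_onb E" for E
  proof (rule nonneg_bdd_above_summable_on)
    show "bdd_above (sum (\<lambda>e. (norm (blinfun_apply (adj A) e))\<^sup>2) ` {F. F \<subseteq> E \<and> finite F})"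
    proof (rule bdd_aboveI2)
      fix F assume "F \<in> {F. F \<subseteq> E \<and> finite F}"
      then show "(\<Sum>e\<in>F. (norm (blinfun_apply (adj A) e))\<^sup>2)
          \<le> (\<Sum>\<^sub>\<infinity>e\<in>E0. (norm (blinfun_apply A e))\<^sup>2)"
        using that by (intro sum_norm_adj_le[OF bA E0 sm]) (auto simp: is_onb_iff intro: orthonormal_subset)
    qed
  qed simp
  then show "is_onb E \<Longrightarrow> (\<lambda>e. (norm (blinfun_apply (adj A) e))\<^sup>2) summable_on E" .
  show "adj A \<in> hilbert_schmidt"
    using * E0 bA unfolding hilbert_schmidt_def by auto
qed

lemma hilbert_schmidt_bounded: "A \<in> hilbert_schmidt \<Longrightarrow> A \<in> bounded_ops"
  by (simp add: hilbert_schmidt_def)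

text \<open>The definition offers one basis only. Passing to the adjoint moves summability to an
  arbitrary basis, and passing back returns to the operator itself.\<close>

lemma hilbert_schmidt_summable:
  fixes A :: "'a :: chilbert_space \<Rightarrow>\<^sub>L 'a"
  assumes "A \<in> hilbert_schmidt" and "is_onb E"
  shows "(\<lambda>e. (norm (blinfun_apply A e))\<^sup>2) summable_on E"
  using hilbert_schmidt_adj(2)[OF hilbert_schmidt_adj(1)[OF assms(1)] assms(2)]
    hilbert_schmidt_bounded[OF assms(1)] by simp

text \<open>A single unit vector is an orthonormal family.\<close>

lemma norm_le_hilbert_schmidt:
  fixes A :: "'a :: chilbert_space \<Rightarrow>\<^sub>L 'a"
  assumes A: "A \<in> hilbert_schmidt" and E: "is_onb E"
  shows "(norm A)\<^sup>2 \<le> (\<Sum>\<^sub>\<infinity>e\<in>E. (norm (blinfun_apply A e))\<^sup>2)"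
proof -
  note bA = hilbert_schmidt_bounded[OF A]
  define S where "S = (\<Sum>\<^sub>\<infinity>e\<in>E. (norm (blinfun_apply A e))\<^sup>2)"
  have S: "S \<ge> 0" unfolding S_def by (rule infsum_nonneg) simp
  have "norm (adj A) \<le> sqrt S"
  proof (rule norm_blinfun_bound)
    fix x :: 'a
    show "norm (blinfun_apply (adj A) x) \<le> sqrt S * norm x"
    proof (cases "x = 0")
      case False
      define u where "u = (1 / norm x) *\<^sub>R x"
      have "orthonormal {u}" using False by (simp add: orthonormal_def u_def)
      then have "(norm (blinfun_apply (adj A) u))\<^sup>2 \<le> S"
        using sum_norm_adj_le[OF bA E hilbert_schmidt_summable[OF A E], of "{u}"] by (simp add: S_def)
      then have "norm (blinfun_apply (adj A) u) \<le> sqrt S" by (simp add: real_le_rsqrt)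
      then show ?thesis using False by (simp add: u_def blinfun.scaleR_right field_simps)
    qed simp
  qed (use S in simp)
  then have "norm A \<le> sqrt S" using bA by simp
  then have "(norm A)\<^sup>2 \<le> (sqrt S)\<^sup>2" by (intro power_mono) auto
  then show ?thesis using S by (simp add: S_def)
qed

lemma hilbert_schmidt_compose_left:
  fixes A :: "'a :: chilbert_space \<Rightarrow>\<^sub>L 'a"
  assumes A: "A \<in> hilbert_schmidt" and Y: "Y \<in> bounded_ops"
  shows "Y o\<^sub>L A \<in> hilbert_schmidt"
proof -
  obtain E :: "'a set" where E: "is_onb E" using onb_exists by blast
  have "(\<lambda>e. (norm (blinfun_apply (Y o\<^sub>L A) e))\<^sup>2) summable_on E"
  proof (rule summable_on_comparison_test)
    show "(\<lambda>e. (norm Y)\<^sup>2 * (norm (blinfun_apply A e))\<^sup>2) summable_on E"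
      by (intro summable_on_cmult_right hilbert_schmidt_summable A E)
    show "(norm (blinfun_apply (Y o\<^sub>L A) e))\<^sup>2 \<le> (norm Y)\<^sup>2 * (norm (blinfun_apply A e))\<^sup>2" for e
      by (simp add: norm_blinfun power_mono flip: power_mult_distrib)
  qed simp
  then show ?thesis
    using E Y hilbert_schmidt_bounded[OF A] by (auto simp: hilbert_schmidt_def)
qed

subsection \<open>Positive operators and square roots\<close>

lemma positive_op_bounded: "positive_op P \<Longrightarrow> P \<in> bounded_ops"
  by (simp add: positive_op_def)

lemma positive_op_nonneg: "positive_op P \<Longrightarrow> 0 \<le> Re (cinner (blinfun_apply P x) x)"
  by (simp add: positive_op_def)

text \<open>Polarisation: the sesquilinear form h measures the failure of symmetry and vanishes on
  the diagonal because the quadratic form is real.\<close>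

lemma positive_op_self_adjoint:
  fixes P :: "'a :: chilbert_space \<Rightarrow>\<^sub>L 'a"
  assumes P: "positive_op P"
  shows "cinner (blinfun_apply P x) y = cinner x (blinfun_apply P y)"
proof -
  define h where "h = (\<lambda>x y. cinner (blinfun_apply P x) y - cinner x (blinfun_apply P y))"
  have "cinner (blinfun_apply P x) x = cinner x (blinfun_apply P x)" for x
    using P unfolding positive_op_def by (metis Reals_cnj_iff cinner_commute)
  then have "h z z = 0" for z by (simp add: h_def)
  then have "h (x + y) (x + y) = 0" "h x x = 0" "h y y = 0" for x y by blast+
  then have anti: "h x y + h y x = 0" for x y
    by (simp add: h_def blinfun.add_right cinner_add_left cinner_add_right algebra_simps)
  \<comment> \<open>Replacing y by \<i> y turns antisymmetry of h into symmetry; both together force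
    h = 0.\<close>
  have "h x (\<i> *\<^sub>C y) = - \<i> * h x y" "h (\<i> *\<^sub>C y) x = \<i> * h y x"
    by (simp_all add: h_def bounded_opsD[OF positive_op_bounded[OF P]] cinner_scaleC_left
        cinner_scaleC_right algebra_simps)
  then have "\<i> * (h y x - h x y) = 0" using anti[of x "\<i> *\<^sub>C y"] by (simp add: algebra_simps)
  then have "h x y = 0" using anti[of x y] by simp
  then show ?thesis by (simp add: h_def)
qed

lemma positive_op_adj: "positive_op P \<Longrightarrow> adj P = P"
  by (rule adj_equality) (rule positive_op_self_adjoint)

lemma positive_opI:
  fixes P :: "'a :: chilbert_space \<Rightarrow>\<^sub>L 'a"
  assumes "P \<in> bounded_ops"
    and "\<And>x y. cinner (blinfun_apply P x) y = cinner x (blinfun_apply P y)"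
    and "\<And>x. 0 \<le> Re (cinner (blinfun_apply P x) x)"
  shows "positive_op P"
  unfolding positive_op_def by (metis assms Reals_cnj_iff cinner_commute)

text \<open>Positivity is tested at x - t P x. The estimate stands in for Cauchy-Schwarz with
  respect to the form of P.\<close>

lemma positive_op_norm_square_le:
  fixes P :: "'a :: chilbert_space \<Rightarrow>\<^sub>L 'a"
  assumes P: "positive_op P"
  shows "(norm (blinfun_apply P x))\<^sup>2 \<le> norm P * Re (cinner (blinfun_apply P x) x)"
proof (cases "P = 0")
  case False
  define q where "q = (norm (blinfun_apply P x))\<^sup>2"
  define y where "y = blinfun_apply P x"
  have q: "q \<ge> 0" by (simp add: q_def)
  \<comment> \<open>This value minimises the upper bound -2 t q + t^2 (norm P) q used below.\<close>
  define t where "t = 1 / norm P"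
  have t: "t > 0" "t * norm P = 1" using False by (auto simp: t_def)
  have yy: "Re (cinner (blinfun_apply P y) x) = q" "Re (cinner (blinfun_apply P x) y) = q"
    by (simp_all add: positive_op_self_adjoint[OF P] y_def q_def cinner_self flip: of_real_power)
  have "Re (cinner (blinfun_apply P y) y) \<le> norm (blinfun_apply P y) * norm y"
    by (meson complex_Re_le_cmod norm_cinner_le order_trans)
  also have "\<dots> \<le> norm P * norm y * norm y" by (intro mult_right_mono norm_blinfun) auto
  finally have Pyy: "Re (cinner (blinfun_apply P y) y) \<le> norm P * q"
    by (simp add: q_def y_def power2_eq_square mult.assoc)
  have "0 \<le> Re (cinner (blinfun_apply P (x - t *\<^sub>R y)) (x - t *\<^sub>R y))"
    by (rule positive_op_nonneg[OF P])
  also have "\<dots> = Re (cinner (blinfun_apply P x) x) - 2 * t * q + t * (t * Re (cinner (blinfun_apply P y) y))"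
    by (simp add: blinfun.diff_right blinfun.scaleR_right cinner_diff_left cinner_diff_right
        cinner_scaleR_left cinner_scaleR_right yy algebra_simps)
  also have "\<dots> \<le> Re (cinner (blinfun_apply P x) x) - 2 * t * q + t * (t * (norm P * q))"
    using t Pyy by (intro add_left_mono mult_left_mono) auto
  also have "\<dots> = Re (cinner (blinfun_apply P x) x) - t * q"
    using t by (simp add: algebra_simps)
  finally have "norm P * (t * q) \<le> norm P * Re (cinner (blinfun_apply P x) x)"
    by (intro mult_left_mono) auto
  moreover have "norm P * (t * q) = q"
    by (simp only: mult.assoc[symmetric] mult.commute[of "norm P" t] t(2) mult_1)
  ultimately have "q \<le> norm P * Re (cinner (blinfun_apply P x) x)" by (simp only:)
  then show ?thesis by (simp only: q_def)
qed simp

text \<open>In the expansion of the squared norm of x - c P x, the quadratic term is absorbed by the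
  linear one as long as c times \<open>norm P\<close> is at most 1.\<close>

lemma norm_id_minus_positive_le:
  fixes P :: "'a :: chilbert_space \<Rightarrow>\<^sub>L 'a"
  assumes P: "positive_op P" and c: "0 \<le> c" "c * norm P \<le> 1"
  shows "norm (id_blinfun - c *\<^sub>R P) \<le> 1"
proof (rule norm_blinfun_bound)
  fix x
  let ?r = "Re (cinner x (blinfun_apply P x))"
  have r: "?r = Re (cinner (blinfun_apply P x) x)" by (simp add: positive_op_self_adjoint[OF P])
  have "c\<^sup>2 * (norm (blinfun_apply P x))\<^sup>2 \<le> c * (c * (norm P * ?r))"
    unfolding power2_eq_square[of c] mult.assoc r
    using positive_op_norm_square_le[OF P, of x] c by (intro mult_left_mono) auto
  also have "\<dots> = c * ?r * (c * norm P)" by simp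
  also have "\<dots> \<le> c * ?r"
    using c positive_op_nonneg[OF P, of x] by (intro mult_left_le) (auto simp: r)
  also have "\<dots> \<le> 2 * (c * ?r)" using c positive_op_nonneg[OF P, of x] by (simp add: r)
  finally have "(norm (x - c *\<^sub>R blinfun_apply P x))\<^sup>2 \<le> (norm x)\<^sup>2"
    by (simp add: norm_diff_square cinner_scaleR_right power_mult_distrib)
  then have "norm (x - c *\<^sub>R blinfun_apply P x) \<le> norm x" by (rule power2_le_imp_le) simp
  then show "norm (blinfun_apply (id_blinfun - c *\<^sub>R P) x) \<le> 1 * norm x"
    by (simp add: blinfun.diff_left blinfun.scaleR_left)
qed simp

text \<open>
  With \<open>P = 1 - Y\<close>, the equation \<open>P\<^sup>2 = 1 - K\<close> becomes the fixed point equation \<open>Y = (K + Y\<^sup>2) / 2\<close>.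
  The iterates starting at \<open>0\<close> are majorised, increments included, by those of the scalar map
  \<open>y \<mapsto> (1 + y\<^sup>2) / 2\<close>, which increase to \<open>1\<close>.
\<close>

fun sqrt_iter :: "('a :: real_normed_vector \<Rightarrow>\<^sub>L 'a) \<Rightarrow> nat \<Rightarrow> ('a \<Rightarrow>\<^sub>L 'a)" where
  "sqrt_iter K 0 = 0"
| "sqrt_iter K (Suc n) = (1 / 2) *\<^sub>R (K + (sqrt_iter K n o\<^sub>L sqrt_iter K n))"

fun sqrt_iter_bound :: "nat \<Rightarrow> real" where
  "sqrt_iter_bound 0 = 0"
| "sqrt_iter_bound (Suc n) = (1 + (sqrt_iter_bound n)\<^sup>2) / 2"

lemma sqrt_iter_bound_range: "0 \<le> sqrt_iter_bound n \<and> sqrt_iter_bound n \<le> 1"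
  by (induction n) (auto simp: power_le_one)

lemma sqrt_iter_bound_incseq: "incseq sqrt_iter_bound"
proof (rule incseq_SucI)
  fix n
  have "0 \<le> (1 - sqrt_iter_bound n)\<^sup>2" by simp
  then show "sqrt_iter_bound n \<le> sqrt_iter_bound (Suc n)"
    by (simp add: power2_eq_square algebra_simps)
qed

lemma norm_sqrt_iter_le:
  assumes K: "norm K \<le> 1"
  shows "norm (sqrt_iter K n) \<le> sqrt_iter_bound n"
proof (induction n)
  case (Suc n)
  have "norm (K + (sqrt_iter K n o\<^sub>L sqrt_iter K n)) \<le> 1 + norm (sqrt_iter K n) * norm (sqrt_iter K n)"
    by (rule order_trans[OF norm_triangle_ineq add_mono[OF K norm_blinfun_compose]])
  also have "\<dots> \<le> 1 + sqrt_iter_bound n * sqrt_iter_bound n"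
    using Suc sqrt_iter_bound_range[of n] by (intro add_left_mono mult_mono) auto
  finally show ?case by (simp add: power2_eq_square)
qed simp

text \<open>The difference of squares is written as Z (Z - Y) + (Z - Y) Y, which needs no
  commutation; the scalar majorant satisfies the same identity with equality.\<close>

lemma norm_sqrt_iter_step_le:
  assumes K: "norm K \<le> 1"
  shows "norm (sqrt_iter K (Suc n) - sqrt_iter K n) \<le> sqrt_iter_bound (Suc n) - sqrt_iter_bound n"
proof (induction n)
  case 0
  then show ?case using K by simp
next
  case (Suc n)
  define Y where "Y = sqrt_iter K n"
  define Z where "Z = sqrt_iter K (Suc n)"
  define y where "y = sqrt_iter_bound n"
  define z where "z = sqrt_iter_bound (Suc n)"
  have Zn: "norm Z \<le> z" and Yn: "norm Y \<le> y"
    unfolding Z_def Y_def z_def y_def by (rule norm_sqrt_iter_le[OF K])+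
  have ZY: "norm (Z - Y) \<le> z - y" using Suc by (simp only: Y_def Z_def y_def z_def)
  have "sqrt_iter K (Suc (Suc n)) - Z = (1/2) *\<^sub>R ((K + (Z o\<^sub>L Z)) - (K + (Y o\<^sub>L Y)))"
    unfolding scaleR_diff_right unfolding Z_def Y_def by (simp only: sqrt_iter.simps)
  also have "(K + (Z o\<^sub>L Z)) - (K + (Y o\<^sub>L Y)) = (Z o\<^sub>L (Z - Y)) + ((Z - Y) o\<^sub>L Y)"
    by (rule blinfun_eqI) (simp add: blinfun.diff_left blinfun.add_left blinfun.diff_right)
  also have "norm ((1/2) *\<^sub>R \<dots>) \<le> (1/2) * (norm Z * norm (Z - Y) + norm (Z - Y) * norm Y)"
    by (simp add: norm_triangle_le add_mono norm_blinfun_compose)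
  also have "\<dots> \<le> (1/2) * (z * (z - y) + (z - y) * y)"
    using Zn Yn ZY order_trans[OF norm_ge_zero Zn] order_trans[OF norm_ge_zero ZY]
    by (intro mult_left_mono add_mono mult_mono) auto
  also have "\<dots> = sqrt_iter_bound (Suc (Suc n)) - z"
  proof -
    have "z = (1 + y\<^sup>2) / 2" by (simp add: z_def y_def)
    moreover have "sqrt_iter_bound (Suc (Suc n)) = (1 + z\<^sup>2) / 2" by (simp add: z_def)
    ultimately show ?thesis by (simp add: power2_eq_square algebra_simps)
  qed
  finally show ?case unfolding Z_def z_def .
qed

text \<open>When \<open>norm K\<close> is 1 there is no uniform contraction factor below 1, so
  convergence is transferred from the bounded monotone scalar sequence by summing
  increments.\<close>

lemma sqrt_iter_convergent:
  fixes K :: "'a :: banach \<Rightarrow>\<^sub>L 'a"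
  assumes K: "norm K \<le> 1"
  obtains Y where "sqrt_iter K \<longlonglongrightarrow> Y"
proof -
  have le: "norm (sqrt_iter K m - sqrt_iter K n) \<le> sqrt_iter_bound m - sqrt_iter_bound n" if "n \<le> m" for m n
    using that
  proof (induction m rule: dec_induct)
    case (step m)
    have "norm (sqrt_iter K (Suc m) - sqrt_iter K n)
        \<le> norm (sqrt_iter K (Suc m) - sqrt_iter K m) + norm (sqrt_iter K m - sqrt_iter K n)"
      by (metis diff_add_cancel add_diff_eq norm_triangle_ineq)
    then show ?case using step.IH norm_sqrt_iter_step_le[OF K, of m] by linarith
  qed simp
  have "convergent sqrt_iter_bound"
    by (rule Bseq_mono_convergent)
      (use sqrt_iter_bound_range sqrt_iter_bound_incseq in \<open>auto intro!: BseqI'[where K = 1] simp: incseq_def\<close>)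
  then have cau: "Cauchy sqrt_iter_bound" by (rule convergent_Cauchy)
  have "Cauchy (sqrt_iter K)"
  proof (rule CauchyI)
    fix e :: real assume "e > 0"
    then obtain N where N: "\<And>m n. m \<ge> N \<Longrightarrow> n \<ge> N \<Longrightarrow> norm (sqrt_iter_bound m - sqrt_iter_bound n) < e"
      using CauchyD[OF cau] by metis
    have "norm (sqrt_iter K m - sqrt_iter K n) < e" if "m \<ge> N" "n \<ge> N" for m n
      using N[OF that] le[of m n] le[of n m]
      by (cases "n \<le> m") (auto simp: norm_minus_commute)
    then show "\<exists>N. \<forall>m\<ge>N. \<forall>n\<ge>N. norm (sqrt_iter K m - sqrt_iter K n) < e" by blast
  qed
  then show ?thesis using that by (auto simp: Cauchy_convergent_iff convergent_def)
qed

text \<open>Symmetry and commutation hold for every iterate and survive the limit. The last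
  conclusion, that the root commutes with whatever commutes with K, is what uniqueness will rest
  on.\<close>

lemma contraction_sqrt_exists:
  fixes K :: "'a :: chilbert_space \<Rightarrow>\<^sub>L 'a"
  assumes bK: "K \<in> bounded_ops" and K: "norm K \<le> 1"
    and sa: "\<And>x y. cinner (blinfun_apply K x) y = cinner x (blinfun_apply K y)"
  obtains P where "positive_op P" "P o\<^sub>L P = id_blinfun - K"
    "\<And>Z. Z o\<^sub>L K = K o\<^sub>L Z \<Longrightarrow> Z o\<^sub>L P = P o\<^sub>L Z"
proof -
  obtain Y where Y: "sqrt_iter K \<longlonglongrightarrow> Y" by (rule sqrt_iter_convergent[OF K])
  have lim: "(\<lambda>n. blinfun_apply (sqrt_iter K n) x) \<longlonglongrightarrow> blinfun_apply Y x" for x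
    by (intro blinfun.tendsto Y tendsto_const)
  have "sqrt_iter K n \<in> bounded_ops" for n by (induction n) (auto simp: bK)
  then have bY: "Y \<in> bounded_ops" by (rule bounded_ops_limit[OF _ Y])
  have "norm (sqrt_iter K n) \<le> 1" for n
    using norm_sqrt_iter_le[OF K, of n] sqrt_iter_bound_range[of n] by linarith
  then have nY: "norm Y \<le> 1" by (intro LIMSEQ_le_const2[OF tendsto_norm[OF Y]]) auto
  have "(\<lambda>n. (1 / 2) *\<^sub>R (K + (sqrt_iter K n o\<^sub>L sqrt_iter K n))) \<longlonglongrightarrow> (1 / 2) *\<^sub>R (K + (Y o\<^sub>L Y))"
    by (intro tendsto_intros bounded_bilinear.tendsto[OF bounded_bilinear_blinfun_compose] Y)
  then have "(\<lambda>n. sqrt_iter K (Suc n)) \<longlonglongrightarrow> (1 / 2) *\<^sub>R (K + (Y o\<^sub>L Y))" by simp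
  then have fp: "Y = (1 / 2) *\<^sub>R (K + (Y o\<^sub>L Y))"
    using LIMSEQ_Suc[OF Y] LIMSEQ_unique by blast
  have sa_iter: "cinner (blinfun_apply (sqrt_iter K n) x) y = cinner x (blinfun_apply (sqrt_iter K n) y)" for n x y
    by (induction n arbitrary: x y)
      (auto simp: blinfun.scaleR_left blinfun.add_left cinner_scaleR_left cinner_scaleR_right
        cinner_add_left cinner_add_right sa)
  have saY: "cinner (blinfun_apply Y x) y = cinner x (blinfun_apply Y y)" for x y
  proof (rule LIMSEQ_unique)
    show "(\<lambda>n. cinner (blinfun_apply (sqrt_iter K n) x) y) \<longlonglongrightarrow> cinner (blinfun_apply Y x) y"
      by (intro tendsto_cinner lim tendsto_const)
    show "(\<lambda>n. cinner (blinfun_apply (sqrt_iter K n) x) y) \<longlonglongrightarrow> cinner x (blinfun_apply Y y)"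
      unfolding sa_iter by (intro tendsto_cinner lim tendsto_const)
  qed
  have comm: "Z o\<^sub>L Y = Y o\<^sub>L Z" if ZK: "Z o\<^sub>L K = K o\<^sub>L Z" for Z
  proof -
    have ZK': "blinfun_apply Z (blinfun_apply K x) = blinfun_apply K (blinfun_apply Z x)" for x
      by (metis ZK blinfun_apply_blinfun_compose)
    have "blinfun_apply Z (blinfun_apply (sqrt_iter K n) x) = blinfun_apply (sqrt_iter K n) (blinfun_apply Z x)" for n x
      by (induction n arbitrary: x)
        (auto simp: blinfun.scaleR_left blinfun.add_left blinfun.scaleR_right blinfun.add_right ZK')
    then have "Z o\<^sub>L sqrt_iter K n = sqrt_iter K n o\<^sub>L Z" for n
      by (intro blinfun_eqI) simp
    moreover have "(\<lambda>n. Z o\<^sub>L sqrt_iter K n) \<longlonglongrightarrow> (Z o\<^sub>L Y)" "(\<lambda>n. sqrt_iter K n o\<^sub>L Z) \<longlonglongrightarrow> (Y o\<^sub>L Z)"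
      by (intro bounded_bilinear.tendsto[OF bounded_bilinear_blinfun_compose] Y tendsto_const)+
    ultimately show ?thesis using LIMSEQ_unique by auto
  qed
  show thesis
  proof (rule that[of "id_blinfun - Y"])
    show "positive_op (id_blinfun - Y)"
    proof (rule positive_opI)
      fix x y
      show "cinner (blinfun_apply (id_blinfun - Y) x) y = cinner x (blinfun_apply (id_blinfun - Y) y)"
        by (simp add: blinfun.diff_left cinner_diff_left cinner_diff_right saY)
      have "Re (cinner (blinfun_apply Y x) x) \<le> norm (blinfun_apply Y x) * norm x"
        by (meson complex_Re_le_cmod norm_cinner_le order_trans)
      also have "\<dots> \<le> norm Y * norm x * norm x" by (intro mult_right_mono norm_blinfun) auto
      also have "\<dots> \<le> 1 * norm x * norm x" using nY by (intro mult_right_mono) auto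
      finally show "0 \<le> Re (cinner (blinfun_apply (id_blinfun - Y) x) x)"
        by (simp add: blinfun.diff_left cinner_diff_left cinner_self power2_eq_square)
    qed (use bY in simp)
    show "(id_blinfun - Y) o\<^sub>L (id_blinfun - Y) = id_blinfun - K"
    proof (rule blinfun_eqI)
      fix x
      have "2 *\<^sub>R blinfun_apply Y x = blinfun_apply K x + blinfun_apply Y (blinfun_apply Y x)"
        by (subst fp) (simp add: blinfun.scaleR_left blinfun.add_left)
      then show "blinfun_apply ((id_blinfun - Y) o\<^sub>L (id_blinfun - Y)) x = blinfun_apply (id_blinfun - K) x"
        by (simp add: blinfun.diff_left blinfun.diff_right scaleR_2 algebra_simps)
    qed
    fix Z assume "Z o\<^sub>L K = K o\<^sub>L Z"
    then have "Z o\<^sub>L Y = Y o\<^sub>L Z" by (rule comm)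
    then have "blinfun_apply Z (blinfun_apply Y x) = blinfun_apply Y (blinfun_apply Z x)" for x
      by (metis blinfun_apply_blinfun_compose)
    then show "Z o\<^sub>L (id_blinfun - Y) = (id_blinfun - Y) o\<^sub>L Z"
      by (intro blinfun_eqI) (simp add: blinfun.diff_left blinfun.diff_right)
  qed
qed

lemma positive_sqrt_exists:
  fixes T :: "'a :: chilbert_space \<Rightarrow>\<^sub>L 'a"
  assumes T: "positive_op T"
  obtains P where "positive_op P" "P o\<^sub>L P = T" "\<And>Z. Z o\<^sub>L T = T o\<^sub>L Z \<Longrightarrow> Z o\<^sub>L P = P o\<^sub>L Z"
proof -
  \<comment> \<open>Scaling makes c T a positive operator of norm at most 1; the added 1 keeps the
    quotient meaningful for T = 0.\<close>
  define c where "c = 1 / (norm T + 1)"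
  have c: "c > 0" "c * norm T \<le> 1"
    by (auto simp: c_def divide_simps add_pos_nonneg add_nonneg_pos)
  define K where "K = id_blinfun - c *\<^sub>R T"
  have T': "T = (1 / c) *\<^sub>R (id_blinfun - K)" using c by (simp add: K_def)
  have "K \<in> bounded_ops" using positive_op_bounded[OF T] by (simp add: K_def)
  moreover have "norm K \<le> 1" unfolding K_def using norm_id_minus_positive_le[OF T] c by simp
  moreover have "cinner (blinfun_apply K x) y = cinner x (blinfun_apply K y)" for x y
    by (simp add: K_def blinfun.diff_left blinfun.scaleR_left cinner_diff_left cinner_diff_right
        cinner_scaleR_left cinner_scaleR_right positive_op_self_adjoint[OF T])
  ultimately obtain P where P: "positive_op P" "P o\<^sub>L P = id_blinfun - K"
    and comm: "\<And>Z. Z o\<^sub>L K = K o\<^sub>L Z \<Longrightarrow> Z o\<^sub>L P = P o\<^sub>L Z"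
    using contraction_sqrt_exists by metis
  \<comment> \<open>Undoes the scaling: the root of T is r times the root of c T.\<close>
  define r where "r = sqrt (1 / c)"
  have r: "r \<ge> 0" "r * r = 1 / c" using c by (simp_all add: r_def)
  show thesis
  proof (rule that[of "r *\<^sub>R P"])
    show "positive_op (r *\<^sub>R P)"
      using positive_op_bounded[OF P(1)] positive_op_nonneg[OF P(1)] r
      by (intro positive_opI) (auto simp: blinfun.scaleR_left cinner_scaleR_left cinner_scaleR_right
          positive_op_self_adjoint[OF P(1)] simp flip: positive_op_self_adjoint[OF P(1)])
    have "(r *\<^sub>R P) o\<^sub>L (r *\<^sub>R P) = (r * r) *\<^sub>R (P o\<^sub>L P)"
      by (rule blinfun_eqI) (simp add: blinfun.scaleR_left blinfun.scaleR_right)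
    then show "(r *\<^sub>R P) o\<^sub>L (r *\<^sub>R P) = T" by (simp add: r P(2) flip: T')
    fix Z assume ZT: "Z o\<^sub>L T = T o\<^sub>L Z"
    have ZT': "blinfun_apply Z (blinfun_apply T x) = blinfun_apply T (blinfun_apply Z x)" for x
      by (metis ZT blinfun_apply_blinfun_compose)
    have "Z o\<^sub>L K = K o\<^sub>L Z"
      by (rule blinfun_eqI) (simp add: K_def blinfun.diff_left blinfun.diff_right blinfun.scaleR_left
          blinfun.scaleR_right ZT')
    then have "Z o\<^sub>L P = P o\<^sub>L Z" by (rule comm)
    then have "blinfun_apply Z (blinfun_apply P x) = blinfun_apply P (blinfun_apply Z x)" for x
      by (metis blinfun_apply_blinfun_compose)
    then show "Z o\<^sub>L r *\<^sub>R P = r *\<^sub>R P o\<^sub>L Z"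
      by (intro blinfun_eqI) (simp add: blinfun.scaleR_left blinfun.scaleR_right)
  qed
qed

lemma positive_op_eq_0:
  assumes "positive_op P" and "Re (cinner (blinfun_apply P x) x) \<le> 0"
  shows "blinfun_apply P x = 0"
proof -
  have "norm P * Re (cinner (blinfun_apply P x) x) \<le> 0"
    using assms(2) by (simp add: mult_nonneg_nonpos)
  then have "(norm (blinfun_apply P x))\<^sup>2 \<le> 0"
    using positive_op_norm_square_le[OF assms(1), of x] by linarith
  then show ?thesis by simp
qed

text \<open>For y = (P - Q) x, commutation gives (P + Q) y = (P^2 - Q^2) x = 0. Both forms are
  nonnegative at y, so P y = Q y = 0, and the squared norm of y is <x, (P - Q) y> = 0.\<close>

lemma commuting_positive_sqrt_unique:
  fixes P Q :: "'a :: chilbert_space \<Rightarrow>\<^sub>L 'a"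
  assumes P: "positive_op P" and Q: "positive_op Q" and sq: "P o\<^sub>L P = Q o\<^sub>L Q"
    and comm: "P o\<^sub>L Q = Q o\<^sub>L P"
  shows "P = Q"
proof (rule blinfun_eqI)
  fix x
  let ?p = "blinfun_apply P" and ?q = "blinfun_apply Q"
  define y where "y = ?p x - ?q x"
  have pq: "?p (?q z) = ?q (?p z)" "?p (?p z) = ?q (?q z)" for z
    by (metis comm sq blinfun_apply_blinfun_compose)+
  have "?p y + ?q y = 0" by (simp add: y_def blinfun.diff_right pq)
  then have "cinner (?p y) y + cinner (?q y) y = 0" by (simp flip: cinner_add_left)
  then have "Re (cinner (?p y) y) + Re (cinner (?q y) y) = 0"
    by (metis plus_complex.sel(1) zero_complex.sel(1))
  then have "?p y = 0" and "?q y = 0"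
    using positive_op_nonneg[OF P, of y] positive_op_nonneg[OF Q, of y]
    by (auto intro!: positive_op_eq_0 P Q)
  moreover have "cinner y y = cinner x (?p y - ?q y)"
    by (simp add: y_def cinner_diff_left cinner_diff_right blinfun.diff_right
        positive_op_self_adjoint[OF P] positive_op_self_adjoint[OF Q])
  ultimately have "y = 0" by (simp add: cinner_self)
  then show "?p x = ?q x" by (simp add: y_def)
qed

text \<open>Any positive root Q commutes with its square T, hence with the constructed root, so
  uniqueness among commuting roots is enough.\<close>

lemma sqrt_op:
  fixes T :: "'a :: chilbert_space \<Rightarrow>\<^sub>L 'a"
  assumes T: "positive_op T"
  shows "positive_op (sqrt_op T)" and "sqrt_op T o\<^sub>L sqrt_op T = T"
proof -
  obtain P where P: "positive_op P" "P o\<^sub>L P = T"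
    and comm: "\<And>Z. Z o\<^sub>L T = T o\<^sub>L Z \<Longrightarrow> Z o\<^sub>L P = P o\<^sub>L Z"
    using positive_sqrt_exists[OF T] by metis
  have "Q = P" if Q: "positive_op Q \<and> Q o\<^sub>L Q = T" for Q
  proof (rule commuting_positive_sqrt_unique)
    have "Q o\<^sub>L (Q o\<^sub>L Q) = (Q o\<^sub>L Q) o\<^sub>L Q" by (rule blinfun_eqI) simp
    then show "Q o\<^sub>L P = P o\<^sub>L Q" using Q by (intro comm) simp
  qed (simp_all add: P Q)
  then have "sqrt_op T = P" unfolding sqrt_op_def using P by (intro the_equality) blast+
  then show "positive_op (sqrt_op T)" and "sqrt_op T o\<^sub>L sqrt_op T = T" by (simp_all add: P)
qed

lemma positive_adj_compose:
  fixes A :: "'a :: chilbert_space \<Rightarrow>\<^sub>L 'a"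
  assumes A: "A \<in> bounded_ops"
  shows "positive_op (adj A o\<^sub>L A)"
  unfolding positive_op_def cinner_adj_compose_self[OF A] using A by simp

lemma abs_op:
  fixes A :: "'a :: chilbert_space \<Rightarrow>\<^sub>L 'a"
  assumes "A \<in> bounded_ops"
  shows "positive_op (abs_op A)" and "abs_op A o\<^sub>L abs_op A = adj A o\<^sub>L A"
  unfolding abs_op_def using sqrt_op[OF positive_adj_compose[OF assms]] by auto

text \<open>Both squared norms are the quadratic form of \<open>adj A o\<^sub>L A\<close>.\<close>

lemma norm_abs_op_apply:
  fixes A :: "'a :: chilbert_space \<Rightarrow>\<^sub>L 'a"
  assumes A: "A \<in> bounded_ops"
  shows "norm (blinfun_apply (abs_op A) x) = norm (blinfun_apply A x)"
proof -
  note P = abs_op(1)[OF A]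
  have "complex_of_real ((norm (blinfun_apply (abs_op A) x))\<^sup>2) = complex_of_real ((norm (blinfun_apply A x))\<^sup>2)"
    using cinner_adj_compose_self[OF positive_op_bounded[OF P], of x] cinner_adj_compose_self[OF A, of x]
    unfolding positive_op_adj[OF P] abs_op(2)[OF A] by simp
  then show ?thesis by (simp only: of_real_eq_iff power2_eq_iff_nonneg norm_ge_zero)
qed

section \<open>Powers of an operator\<close>

lemma op_power_0 [simp]: "op_power A 0 = id_blinfun"
  by (simp add: op_power_def)

lemma op_power_Suc: "op_power A (Suc n) = A o\<^sub>L op_power A n"
  by (simp add: op_power_def)

lemma op_power_apply: "blinfun_apply (op_power A n) x = (blinfun_apply A ^^ n) x"
  by (induction n) (simp_all add: op_power_Suc)

lemma bounded_ops_op_power [simp]: "A \<in> bounded_ops \<Longrightarrow> op_power A n \<in> bounded_ops"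
  by (induction n) (simp_all add: op_power_Suc)

lemma norm_op_power_apply_le: "norm (blinfun_apply (op_power A n) x) \<le> norm A ^ n * norm x"
proof (induction n)
  case (Suc n)
  have "norm (blinfun_apply A (blinfun_apply (op_power A n) x)) \<le> norm A * norm (blinfun_apply (op_power A n) x)"
    by (rule norm_blinfun)
  also have "\<dots> \<le> norm A * (norm A ^ n * norm x)" by (intro mult_left_mono Suc) simp
  finally show ?case by (simp add: op_power_Suc mult.assoc)
qed simp

lemma norm_op_power_le: "norm (op_power A n) \<le> norm A ^ n"
  by (rule norm_blinfun_bound) (simp_all add: norm_op_power_apply_le)

lemma op_power_self_adjoint:
  assumes sa: "\<And>x y. cinner (blinfun_apply A x) y = cinner x (blinfun_apply A y)"
  shows "cinner (blinfun_apply (op_power A n) x) y = cinner x (blinfun_apply (op_power A n) y)"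
  by (induction n arbitrary: x y) (simp_all add: op_power_apply sa funpow_swap1)

lemma op_power_commute:
  assumes "\<And>x. blinfun_apply A (blinfun_apply B x) = blinfun_apply B (blinfun_apply A x)"
  shows "blinfun_apply (op_power A n) (blinfun_apply B x) = blinfun_apply B (blinfun_apply (op_power A n) x)"
  by (induction n arbitrary: x) (simp_all add: op_power_Suc assms)

subsection \<open>The product of two Hilbert-Schmidt operators is trace class\<close>

text \<open>Meant for P = |T|. The smallness of c makes both K = 1 - c P a map of norm at most 1 and
  K P positive, so that the entries <K^n P x, x> are nonnegative and tend to 0.\<close>

locale damped_positive =
  fixes P :: "'a :: chilbert_space \<Rightarrow>\<^sub>L 'a" and c :: real
  assumes P: "positive_op P" and c: "0 < c" "c * norm P \<le> 1"
begin

definition K :: "'a \<Rightarrow>\<^sub>L 'a" where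
  "K = id_blinfun - c *\<^sub>R P"

text \<open>Partial Neumann series of 1 - K = c P: c times \<open>W n\<close> is a bounded
  substitute for the inverse of P, which need not exist.\<close>

definition W :: "nat \<Rightarrow> 'a \<Rightarrow>\<^sub>L 'a" where
  "W n = (\<Sum>k<n. op_power K k)"

lemma K_apply: "blinfun_apply K x = x - c *\<^sub>R blinfun_apply P x"
  by (simp add: K_def blinfun.diff_left blinfun.scaleR_left)

lemma K_power_P:
  "blinfun_apply (op_power K n) (blinfun_apply P x) = blinfun_apply P (blinfun_apply (op_power K n) x)"
  by (rule op_power_commute) (simp add: K_apply blinfun.diff_right blinfun.scaleR_right)

lemma W_P: "blinfun_apply (W n) (blinfun_apply P x) = blinfun_apply P (blinfun_apply (W n) x)"
  by (simp add: W_def blinfun.sum_left blinfun.sum_right K_power_P)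

lemma bounded_W: "W n \<in> bounded_ops"
  using positive_op_bounded[OF P] by (simp add: W_def K_def)

lemma K_self_adjoint: "cinner (blinfun_apply K x) y = cinner x (blinfun_apply K y)"
  by (simp add: K_apply cinner_diff_left cinner_diff_right cinner_scaleR_left cinner_scaleR_right
      positive_op_self_adjoint[OF P])

lemma W_self_adjoint: "cinner (blinfun_apply (W n) x) y = cinner x (blinfun_apply (W n) y)"
proof -
  have "cinner x (\<Sum>k<n. blinfun_apply (op_power K k) y) = (\<Sum>k<n. cinner x (blinfun_apply (op_power K k) y))"
    by (induction n) (simp_all add: cinner_add_right)
  then show ?thesis
    by (simp add: W_def blinfun.sum_left cinner_sum_left op_power_self_adjoint[OF K_self_adjoint])
qed

text \<open>A geometric sum, since c P = 1 - K.\<close>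

lemma W_telescope: "c *\<^sub>R blinfun_apply (W n) (blinfun_apply P x) = x - blinfun_apply (op_power K n) x"
proof (induction n)
  case (Suc n)
  have "c *\<^sub>R blinfun_apply (W (Suc n)) (blinfun_apply P x)
      = c *\<^sub>R blinfun_apply (W n) (blinfun_apply P x) + c *\<^sub>R blinfun_apply (op_power K n) (blinfun_apply P x)"
    by (simp add: W_def blinfun.add_left scaleR_add_right)
  then show ?case
    unfolding Suc by (simp add: op_power_Suc K_apply K_power_P)
qed (simp add: W_def)

lemma norm_K_power_le: "norm (blinfun_apply (op_power K n) x) \<le> norm x"
proof -
  have "norm K \<le> 1" unfolding K_def using norm_id_minus_positive_le[OF P] c by simp
  then have "norm K ^ n * norm x \<le> norm x" by (intro mult_left_le_one_le power_le_one) auto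
  then show ?thesis using norm_op_power_apply_le order_trans by blast
qed

text \<open>The norm of \<open>W n\<close> may grow with n, but composed with P it stays bounded;
  this yields the uniform bound 2 on the substitute for the partial isometry.\<close>

lemma norm_P_W_le: "c * norm (blinfun_apply P (blinfun_apply (W n) x)) \<le> 2 * norm x"
proof -
  have "c * norm (blinfun_apply P (blinfun_apply (W n) x)) = norm (x - blinfun_apply (op_power K n) x)"
    using c by (simp flip: W_telescope W_P)
  also have "\<dots> \<le> norm x + norm (blinfun_apply (op_power K n) x)" by (rule norm_triangle_ineq4)
  finally show ?thesis using norm_K_power_le[of n x] by linarith
qed

text \<open>As K is self-adjoint and commutes with P, half of the powers can be moved to the other
  side, leaving the form of P for even n and that of K P for odd n.\<close>

lemma K_power_P_nonneg: "0 \<le> Re (cinner (blinfun_apply (op_power K n) (blinfun_apply P x)) x)"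
proof -
  define m where "m = n div 2"
  define z where "z = blinfun_apply (op_power K m) x"
  show ?thesis
  proof (cases "even n")
    case True
    then have n: "n = m + m" by (auto simp: m_def)
    have "cinner (blinfun_apply (op_power K n) (blinfun_apply P x)) x = cinner (blinfun_apply P z) z"
      unfolding z_def K_power_P[symmetric] op_power_self_adjoint[OF K_self_adjoint, symmetric]
      by (simp add: op_power_apply n funpow_add)
    then show ?thesis using positive_op_nonneg[OF P] by simp
  next
    case False
    then have n: "n = m + Suc m" by (auto simp: m_def elim: oddE)
    have "cinner (blinfun_apply (op_power K n) (blinfun_apply P x)) x = cinner (blinfun_apply K (blinfun_apply P z)) z"
      unfolding z_def K_power_P[symmetric] op_power_self_adjoint[OF K_self_adjoint, symmetric]
      by (simp only: op_power_apply n funpow_add funpow.simps o_apply)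
    \<comment> \<open>K P = P - c P^2, and the square is dominated by P because of the choice of
      c.\<close>
    also have "\<dots> = cinner (blinfun_apply P z) z - c * cinner (blinfun_apply P z) (blinfun_apply P z)"
      by (simp add: K_apply cinner_diff_left cinner_scaleR_left positive_op_self_adjoint[OF P])
    finally have eq: "Re (cinner (blinfun_apply (op_power K n) (blinfun_apply P x)) x)
        = Re (cinner (blinfun_apply P z) z) - c * (norm (blinfun_apply P z))\<^sup>2"
      by (simp add: cinner_self flip: of_real_power)
    have "c * (norm (blinfun_apply P z))\<^sup>2 \<le> c * (norm P * Re (cinner (blinfun_apply P z) z))"
      using c positive_op_norm_square_le[OF P] by (intro mult_left_mono) auto
    also have "\<dots> = (c * norm P) * Re (cinner (blinfun_apply P z) z)" by simp
    also have "\<dots> \<le> Re (cinner (blinfun_apply P z) z)"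
      using c positive_op_nonneg[OF P, of z] by (intro mult_left_le_one_le) auto
    finally show ?thesis unfolding eq by simp
  qed
qed

text \<open>These are terms of a nonnegative series whose partial sums telescope to a bounded
  quantity, so they must vanish in the limit.\<close>

lemma K_power_P_tendsto_0: "(\<lambda>n. Re (cinner (blinfun_apply (op_power K n) (blinfun_apply P x)) x)) \<longlonglongrightarrow> 0"
proof -
  define a where "a = (\<lambda>n. Re (cinner (blinfun_apply (op_power K n) (blinfun_apply P x)) x))"
  have "summable (\<lambda>n. c * a n)"
  proof (rule summableI_nonneg_bounded)
    fix n
    show "0 \<le> c * a n" using c K_power_P_nonneg by (simp add: a_def)
    have "(\<Sum>k<n. c * a k) = Re (cinner (c *\<^sub>R blinfun_apply (W n) (blinfun_apply P x)) x)"
      by (simp add: a_def W_def blinfun.sum_left cinner_scaleR_left cinner_sum_left sum_distrib_left)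
    also have "\<dots> = (norm x)\<^sup>2 - Re (cinner (blinfun_apply (op_power K n) x) x)"
      by (simp add: W_telescope cinner_diff_left cinner_self flip: of_real_power)
    also have "\<dots> \<le> (norm x)\<^sup>2 + norm (blinfun_apply (op_power K n) x) * norm x"
      using norm_cinner_le[of "blinfun_apply (op_power K n) x" x]
        abs_Re_le_cmod[of "cinner (blinfun_apply (op_power K n) x) x"] by linarith
    also have "\<dots> \<le> (norm x)\<^sup>2 + norm x * norm x"
      by (intro add_left_mono mult_right_mono norm_K_power_le) simp
    finally show "(\<Sum>k<n. c * a k) \<le> (norm x)\<^sup>2 + norm x * norm x" .
  qed
  then have "(\<lambda>n. (1 / c) * (c * a n)) \<longlonglongrightarrow> (1 / c) * 0"
    by (intro tendsto_mult tendsto_const summable_LIMSEQ_zero)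
  then show ?thesis using c by (simp add: a_def)
qed

end

text \<open>
  The operators \<open>V = c W\<^sub>n T\<^sup>*\<close> below play the role of the adjoint of the partial isometry in the polar
  decomposition of \<open>T\<close>: they are bounded by \<open>2\<close> and \<open>V T = (1 - K\<^sup>n) |T|\<close> with
  \<open>K = 1 - c |T|\<close>, which converges strongly to \<open>|T|\<close>.
\<close>

lemma hilbert_schmidt_compose_trace_class:
  fixes X D :: "'a :: chilbert_space \<Rightarrow>\<^sub>L 'a"
  assumes X: "X \<in> hilbert_schmidt" and D: "D \<in> hilbert_schmidt"
  shows "X o\<^sub>L D \<in> trace_class"
proof -
  define T where "T = X o\<^sub>L D"
  have bT: "T \<in> bounded_ops"
    by (simp add: T_def hilbert_schmidt_bounded X D)
  define P where "P = abs_op T"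
  have P: "positive_op P" and PP: "P o\<^sub>L P = adj T o\<^sub>L T" unfolding P_def by (rule abs_op[OF bT])+
  have nP: "norm (blinfun_apply T x) = norm (blinfun_apply P x)" for x
    unfolding P_def by (simp add: norm_abs_op_apply[OF bT])
  define c where "c = 1 / (norm P + 1)"
  have c: "c > 0" "c * norm P \<le> 1"
    by (auto simp: c_def divide_simps add_pos_nonneg add_nonneg_pos)
  interpret damped_positive P c by unfold_locales (rule P c)+
  obtain E :: "'a set" where E: "is_onb E" using onb_exists by blast
  define SX where "SX = (\<Sum>\<^sub>\<infinity>e\<in>E. (norm (blinfun_apply X e))\<^sup>2)"
  define SD where "SD = (\<Sum>\<^sub>\<infinity>e\<in>E. (norm (blinfun_apply D e))\<^sup>2)"
  have smX: "(\<lambda>e. (norm (blinfun_apply X e))\<^sup>2) summable_on E"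
    and smD: "(\<lambda>e. (norm (blinfun_apply D e))\<^sup>2) summable_on E"
    by (intro hilbert_schmidt_summable X D E)+
  have bound: "(\<Sum>e\<in>F. Re (cinner (blinfun_apply P e) e)) \<le> SD + 4 * SX" if F: "finite F" "F \<subseteq> E" for F
  proof -
    define a where "a = (\<lambda>n e. Re (cinner (blinfun_apply (op_power K n) (blinfun_apply P e)) e))"
    have "(\<Sum>e\<in>F. Re (cinner (blinfun_apply P e) e)) \<le> SD + 4 * SX + (\<Sum>e\<in>F. a n e)" for n
    proof -
      define V where "V = c *\<^sub>R (W n o\<^sub>L adj T)"
      have bV: "V \<in> bounded_ops" unfolding V_def using bT bounded_W by simp
      have adjV: "adj V = c *\<^sub>R (T o\<^sub>L W n)"
        unfolding V_def by (rule adj_equality)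
          (simp add: blinfun.scaleR_left cinner_scaleR_left cinner_scaleR_right W_self_adjoint cinner_adj'[OF bT])
      \<comment> \<open>The bound is read off the adjoint, where T comes last and may be replaced by
        P without changing norms.\<close>
      have "norm (adj V) \<le> 2"
        by (rule norm_blinfun_bound) (use norm_P_W_le c in \<open>auto simp: adjV blinfun.scaleR_left nP\<close>)
      then have nV: "norm V \<le> 2" using bV by simp
      have VT: "blinfun_apply V (blinfun_apply T e) = blinfun_apply P e - blinfun_apply (op_power K n) (blinfun_apply P e)" for e
      proof -
        have "blinfun_apply (adj T) (blinfun_apply T e) = blinfun_apply P (blinfun_apply P e)"
          by (metis PP blinfun_apply_blinfun_compose)
        then show ?thesis by (simp add: V_def blinfun.scaleR_left W_telescope)
      qed
      define M where "M = V o\<^sub>L X"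
      have M: "M \<in> hilbert_schmidt" unfolding M_def by (intro hilbert_schmidt_compose_left X bV)
      note bM = hilbert_schmidt_bounded[OF M]
      have "(\<Sum>e\<in>F. Re (cinner (blinfun_apply P e) e) - a n e)
          \<le> (\<Sum>e\<in>F. (norm (blinfun_apply D e))\<^sup>2 + (norm (blinfun_apply (adj M) e))\<^sup>2)"
      proof (rule sum_mono)
        fix e
        let ?d = "norm (blinfun_apply D e)" and ?m = "norm (blinfun_apply (adj M) e)"
        have "Re (cinner (blinfun_apply P e) e) - a n e = Re (cinner (blinfun_apply V (blinfun_apply T e)) e)"
          by (simp add: VT a_def cinner_diff_left)
        \<comment> \<open>V T = M D with M = V X: moving M across leaves one Hilbert-Schmidt
          operator in each argument.\<close>
        also have "\<dots> = Re (cinner (blinfun_apply D e) (blinfun_apply (adj M) e))"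
          by (simp add: T_def M_def flip: cinner_adj[OF bM[unfolded M_def]])
        also have "\<dots> \<le> ?d * ?m" by (meson complex_Re_le_cmod norm_cinner_le order_trans)
        also have "\<dots> \<le> ?d\<^sup>2 + ?m\<^sup>2"
          using sum_squares_bound[of ?d ?m, unfolded mult.assoc]
            mult_nonneg_nonneg[OF norm_ge_zero norm_ge_zero, of "blinfun_apply D e" "blinfun_apply (adj M) e"]
          by linarith
        finally show "Re (cinner (blinfun_apply P e) e) - a n e \<le> ?d\<^sup>2 + ?m\<^sup>2" .
      qed
      also have "\<dots> = (\<Sum>e\<in>F. (norm (blinfun_apply D e))\<^sup>2) + (\<Sum>e\<in>F. (norm (blinfun_apply (adj M) e))\<^sup>2)"
        by (rule sum.distrib)
      also have "\<dots> \<le> SD + (\<Sum>\<^sub>\<infinity>e\<in>E. (norm (blinfun_apply M e))\<^sup>2)"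
        unfolding SD_def using F E
        by (intro add_mono finite_sum_le_infsum smD sum_norm_adj_le bM E hilbert_schmidt_summable M)
          (auto simp: is_onb_iff intro: orthonormal_subset)
      also have "(\<Sum>\<^sub>\<infinity>e\<in>E. (norm (blinfun_apply M e))\<^sup>2) \<le> (\<Sum>\<^sub>\<infinity>e\<in>E. 4 * (norm (blinfun_apply X e))\<^sup>2)"
      proof (rule infsum_mono)
        fix e
        have "norm (blinfun_apply M e) \<le> norm V * norm (blinfun_apply X e)"
          by (simp add: M_def norm_blinfun)
        also have "\<dots> \<le> 2 * norm (blinfun_apply X e)" using nV by (intro mult_right_mono) auto
        finally have "(norm (blinfun_apply M e))\<^sup>2 \<le> (2 * norm (blinfun_apply X e))\<^sup>2"
          by (intro power_mono) auto
        then show "(norm (blinfun_apply M e))\<^sup>2 \<le> 4 * (norm (blinfun_apply X e))\<^sup>2"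
          by (simp add: power_mult_distrib)
      qed (intro hilbert_schmidt_summable M E summable_on_cmult_right smX)+
      also have "(\<Sum>\<^sub>\<infinity>e\<in>E. 4 * (norm (blinfun_apply X e))\<^sup>2) = 4 * SX"
        unfolding SX_def by (rule infsum_cmult_right')
      finally show ?thesis by (simp add: sum_subtractf)
    qed
    \<comment> \<open>The bound does not depend on n, so for a fixed finite F the limit removes the
      error terms.\<close>
    moreover have "(\<lambda>n. SD + 4 * SX + (\<Sum>e\<in>F. a n e)) \<longlonglongrightarrow> SD + 4 * SX + (\<Sum>e\<in>F. 0)"
      unfolding a_def by (intro tendsto_add tendsto_const tendsto_sum K_power_P_tendsto_0)
    ultimately have "(\<Sum>e\<in>F. Re (cinner (blinfun_apply P e) e)) \<le> SD + 4 * SX + (\<Sum>e\<in>F. 0)"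
      by (intro LIMSEQ_le_const) auto
    then show ?thesis by simp
  qed
  have "(\<lambda>e. Re (cinner (blinfun_apply P e) e)) summable_on E"
    by (rule nonneg_bdd_above_summable_on)
      (use positive_op_nonneg[OF P] bound in \<open>auto intro!: bdd_aboveI2[where M = "SD + 4 * SX"]\<close>)
  then have "(\<lambda>e. complex_of_real (Re (cinner (blinfun_apply P e) e))) summable_on E"
    by (rule summable_on_of_real)
  moreover have "complex_of_real (Re (cinner (blinfun_apply P e) e)) = cinner (blinfun_apply P e) e" for e
    using P by (simp add: positive_op_def)
  ultimately show ?thesis
    using bT E unfolding trace_class_def P_def T_def by auto
qed

subsection \<open>Power series of operators\<close>

lemma norm_scaleC_op_le: "norm (scaleC_op c A) \<le> cmod c * norm A"
proof (rule norm_blinfun_bound)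
  fix x
  show "norm (blinfun_apply (scaleC_op c A) x) \<le> cmod c * norm A * norm x"
    by (simp add: scaleC_op.rep_eq norm_scaleC mult.assoc mult_left_mono norm_blinfun)
qed simp

lemma op_series_summable:
  fixes S :: "'a :: chilbert_space \<Rightarrow>\<^sub>L 'a"
  assumes S: "norm S \<le> r" and sm: "summable (\<lambda>n. cmod (\<alpha> n) * r ^ n)"
  shows "summable (\<lambda>n. scaleC_op (\<alpha> n) (op_power S n))"
proof (rule summable_comparison_test'[OF sm])
  fix n
  have "norm (scaleC_op (\<alpha> n) (op_power S n)) \<le> cmod (\<alpha> n) * norm (op_power S n)"
    by (rule norm_scaleC_op_le)
  also have "\<dots> \<le> cmod (\<alpha> n) * r ^ n"
    using norm_op_power_le[of S n] power_mono[OF S, of n] by (intro mult_left_mono) auto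
  finally show "norm (scaleC_op (\<alpha> n) (op_power S n)) \<le> cmod (\<alpha> n) * r ^ n" .
qed

lemma op_series_apply_sums:
  fixes S :: "'a :: chilbert_space \<Rightarrow>\<^sub>L 'a"
  assumes "norm S \<le> r" and "summable (\<lambda>n. cmod (\<alpha> n) * r ^ n)"
  shows "(\<lambda>n. \<alpha> n *\<^sub>C blinfun_apply (op_power S n) x) sums blinfun_apply (op_series \<alpha> S) x"
proof -
  have "(\<lambda>n. scaleC_op (\<alpha> n) (op_power S n)) sums op_series \<alpha> S"
    unfolding op_series_def by (rule summable_sums[OF op_series_summable[OF assms]])
  then have "(\<lambda>n. blinfun_apply (scaleC_op (\<alpha> n) (op_power S n)) x) sums blinfun_apply (op_series \<alpha> S) x"
    by (rule bounded_linear.sums[OF blinfun.bounded_linear_left])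
  then show ?thesis by (simp add: scaleC_op.rep_eq)
qed

lemma cinner_op_series_sums:
  fixes S :: "'a :: chilbert_space \<Rightarrow>\<^sub>L 'a"
  assumes "norm S \<le> r" and "summable (\<lambda>n. cmod (\<alpha> n) * r ^ n)"
  shows "(\<lambda>n. \<alpha> n * cinner (blinfun_apply (op_power S n) x) y) sums cinner (blinfun_apply (op_series \<alpha> S) x) y"
  using bounded_linear.sums[OF bounded_linear_cinner_left op_series_apply_sums[OF assms]]
  by (simp add: cinner_scaleC_left)

lemma bounded_ops_op_series:
  fixes S :: "'a :: chilbert_space \<Rightarrow>\<^sub>L 'a"
  assumes S: "S \<in> bounded_ops" "norm S \<le> r" and sm: "summable (\<lambda>n. cmod (\<alpha> n) * r ^ n)"
  shows "op_series \<alpha> S \<in> bounded_ops"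
proof (rule bounded_ops_limit)
  show "(\<lambda>N. \<Sum>n<N. scaleC_op (\<alpha> n) (op_power S n)) \<longlonglongrightarrow> op_series \<alpha> S"
    unfolding op_series_def by (rule summable_LIMSEQ[OF op_series_summable[OF S(2) sm]])
qed (simp add: S)

text \<open>Without a constant term one factor S can be split off on the right. Shifting the
  coefficients costs a division by r.\<close>

lemma op_series_factor:
  fixes S :: "'a :: chilbert_space \<Rightarrow>\<^sub>L 'a"
  assumes S: "norm S \<le> r" and r: "r > 0" and sm: "summable (\<lambda>n. cmod (\<alpha> n) * r ^ n)"
    and 0: "\<alpha> 0 = 0"
  shows "summable (\<lambda>n. cmod (\<alpha> (Suc n)) * r ^ n)"
    and "op_series \<alpha> S = op_series (\<lambda>n. \<alpha> (Suc n)) S o\<^sub>L S"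
proof -
  have "summable (\<lambda>n. cmod (\<alpha> (Suc n)) * r ^ Suc n)"
    using sm by (subst summable_Suc_iff)
  then have "summable (\<lambda>n. cmod (\<alpha> (Suc n)) * r ^ Suc n * (1 / r))"
    by (rule summable_mult2)
  then show sm': "summable (\<lambda>n. cmod (\<alpha> (Suc n)) * r ^ n)" using r by simp
  show "op_series \<alpha> S = op_series (\<lambda>n. \<alpha> (Suc n)) S o\<^sub>L S"
  proof (rule blinfun_eqI)
    fix x
    have "(\<lambda>n. \<alpha> (Suc n) *\<^sub>C blinfun_apply (op_power S (Suc n)) x) sums
        blinfun_apply (op_series (\<lambda>n. \<alpha> (Suc n)) S) (blinfun_apply S x)"
      using op_series_apply_sums[OF S sm', of "blinfun_apply S x"]
      by (simp add: op_power_apply funpow_swap1)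
    then have "(\<lambda>n. \<alpha> n *\<^sub>C blinfun_apply (op_power S n) x) sums
        blinfun_apply (op_series (\<lambda>n. \<alpha> (Suc n)) S) (blinfun_apply S x)"
      by (subst (asm) sums_Suc_iff) (simp add: 0)
    from sums_unique2[OF op_series_apply_sums[OF S sm] this]
    show "blinfun_apply (op_series \<alpha> S) x = blinfun_apply (op_series (\<lambda>n. \<alpha> (Suc n)) S o\<^sub>L S) x"
      by simp
  qed
qed

lemma finite_dim_trace_class:
  fixes T :: "'a :: chilbert_space \<Rightarrow>\<^sub>L 'a"
  assumes "finite_dim TYPE('a)" and "T \<in> bounded_ops"
  shows "T \<in> trace_class"
proof -
  obtain E :: "'a set" where E: "is_onb E" using onb_exists by blast
  then have "finite E" using finite_onb assms(1) by (auto simp: is_onb_iff)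
  then show ?thesis unfolding trace_class_def using assms(2) E by (auto intro: summable_on_finite)
qed

lemma op_series_trace_class:
  fixes C D :: "'a :: chilbert_space \<Rightarrow>\<^sub>L 'a"
  assumes C: "C \<in> hilbert_schmidt" and D: "D \<in> hilbert_schmidt"
    and r: "r > 0" "norm (adj C o\<^sub>L D) \<le> r" and sm: "summable (\<lambda>n. cmod (\<alpha> n) * r ^ n)"
    and or: "\<alpha> 0 = 0 \<or> finite_dim TYPE('a)"
  shows "op_series \<alpha> (adj C o\<^sub>L D) \<in> trace_class"
proof -
  have bS: "adj C o\<^sub>L D \<in> bounded_ops" using C D by (simp add: hilbert_schmidt_bounded)
  show ?thesis
  proof (cases "finite_dim TYPE('a)")
    case True
    then show ?thesis by (rule finite_dim_trace_class) (rule bounded_ops_op_series[OF bS r(2) sm])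
  next
    case False
    then have 0: "\<alpha> 0 = 0" using or by blast
    define Y where "Y = op_series (\<lambda>n. \<alpha> (Suc n)) (adj C o\<^sub>L D)"
    note factor = op_series_factor[OF r(2,1) sm 0]
    have "Y \<in> bounded_ops" unfolding Y_def by (rule bounded_ops_op_series[OF bS r(2) factor(1)])
    then have "Y o\<^sub>L adj C \<in> hilbert_schmidt"
      by (intro hilbert_schmidt_compose_left hilbert_schmidt_adj C)
    then have "(Y o\<^sub>L adj C) o\<^sub>L D \<in> trace_class"
      using D by (rule hilbert_schmidt_compose_trace_class)
    moreover have "(Y o\<^sub>L adj C) o\<^sub>L D = op_series \<alpha> (adj C o\<^sub>L D)"
      unfolding factor(2) Y_def by (rule blinfun_eqI) simp
    ultimately show ?thesis by simp
  qed
qed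

subsection \<open>Cauchy-Schwarz estimates\<close>

text \<open>Hypothesis and conclusion have the same shape, so the estimate can be iterated: over n
  for each vector, then over the basis.\<close>

lemma norm_sum_square_le:
  fixes w :: "'i \<Rightarrow> complex"
  assumes "\<And>i. (cmod (w i))\<^sup>2 \<le> u i * v i" and "\<And>i. 0 \<le> u i" and "\<And>i. 0 \<le> v i"
  shows "(cmod (sum w I))\<^sup>2 \<le> sum u I * sum v I"
proof -
  have "cmod (w i) \<le> sqrt (u i) * sqrt (v i)" for i
    using assms(1)[of i] by (simp add: real_le_rsqrt flip: real_sqrt_mult)
  then have "cmod (sum w I) \<le> (\<Sum>i\<in>I. sqrt (u i) * sqrt (v i))"
    by (intro sum_norm_le) auto
  then have "(cmod (sum w I))\<^sup>2 \<le> (\<Sum>i\<in>I. sqrt (u i) * sqrt (v i))\<^sup>2" by (intro power_mono) auto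
  also have "\<dots> \<le> (\<Sum>i\<in>I. (sqrt (u i))\<^sup>2) * (\<Sum>i\<in>I. (sqrt (v i))\<^sup>2)" by (rule Cauchy_Schwarz_ineq_sum)
  finally show ?thesis using assms by simp
qed

lemma norm_sums_square_le:
  fixes w :: "nat \<Rightarrow> complex"
  assumes "w sums W" "u sums U" "v sums V"
    and le: "\<And>i. (cmod (w i))\<^sup>2 \<le> u i * v i" "\<And>i. 0 \<le> u i" "\<And>i. 0 \<le> v i"
  shows "(cmod W)\<^sup>2 \<le> U * V"
proof (rule LIMSEQ_le)
  show "(\<lambda>N. (cmod (\<Sum>n<N. w n))\<^sup>2) \<longlonglongrightarrow> (cmod W)\<^sup>2"
    using assms(1) unfolding sums_def by (intro tendsto_intros)
  show "(\<lambda>N. (\<Sum>n<N. u n) * (\<Sum>n<N. v n)) \<longlonglongrightarrow> U * V"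
    using assms(2,3) unfolding sums_def by (intro tendsto_intros)
qed (use norm_sum_square_le[of w u v, OF le] in auto)

text \<open>From u v \<le> (u + v)^2 follows |w| \<le> u + v, which gives summability; the
  inequality passes from finite sums to the limit.\<close>

lemma norm_infsum_square_le:
  fixes w :: "'i \<Rightarrow> complex"
  assumes u: "u summable_on E" and v: "v summable_on E"
    and le: "\<And>i. (cmod (w i))\<^sup>2 \<le> u i * v i" "\<And>i. 0 \<le> u i" "\<And>i. 0 \<le> v i"
  shows "w summable_on E" and "(cmod (infsum w E))\<^sup>2 \<le> infsum u E * infsum v E"
proof -
  have bound: "cmod (w i) \<le> u i + v i" for i
  proof (rule power2_le_imp_le)
    have "u i * v i \<le> (u i + v i)\<^sup>2"
      using le(2)[of i] le(3)[of i] by (simp add: power2_sum)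
    then show "(cmod (w i))\<^sup>2 \<le> (u i + v i)\<^sup>2" using le(1)[of i] by linarith
  qed (use le in simp)
  have "(\<lambda>i. u i + v i) summable_on E" using u v by (rule summable_on_add)
  then have "(\<lambda>i. norm (w i)) summable_on E"
    by (rule summable_on_comparison_test) (simp_all add: bound)
  then show sm: "w summable_on E" by (rule abs_summable_summable)
  show "(cmod (infsum w E))\<^sup>2 \<le> infsum u E * infsum v E"
  proof (rule tendsto_upperbound)
    show "((\<lambda>F. (cmod (sum w F))\<^sup>2) \<longlongrightarrow> (cmod (infsum w E))\<^sup>2) (finite_subsets_at_top E)"
      using has_sum_infsum[OF sm] unfolding has_sum_def by (intro tendsto_intros)
    have "(cmod (sum w F))\<^sup>2 \<le> infsum u E * infsum v E" if "finite F" "F \<subseteq> E" for F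
    proof -
      have "(cmod (sum w F))\<^sup>2 \<le> sum u F * sum v F" by (rule norm_sum_square_le[OF le])
      also have "\<dots> \<le> infsum u E * infsum v E"
        by (intro mult_mono finite_sum_le_infsum u v that sum_nonneg infsum_nonneg le(2,3))
      finally show ?thesis .
    qed
    then show "\<forall>\<^sub>F F in finite_subsets_at_top E. (cmod (sum w F))\<^sup>2 \<le> infsum u E * infsum v E"
      by (intro eventually_finite_subsets_at_top_weakI)
  qed simp
qed

text \<open>Each step moves one factor \<open>adj C\<close> to the other side as C, while D passes
  through the remaining power because it commutes with the product. Both vectors change, hence the
  generalised induction. For D = C the hypothesis is normality.\<close>

lemma cinner_op_power_adj_compose:
  fixes C D :: "'a :: chilbert_space \<Rightarrow>\<^sub>L 'a"
  assumes C: "C \<in> bounded_ops" and comm: "adj C o\<^sub>L D = D o\<^sub>L adj C"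
  shows "cinner (blinfun_apply (op_power (adj C o\<^sub>L D) n) x) y
    = cinner (blinfun_apply (op_power D n) x) (blinfun_apply (op_power C n) y)"
proof (induction n arbitrary: x y)
  case (Suc n)
  let ?S = "adj C o\<^sub>L D"
  have DC: "blinfun_apply (adj C) (blinfun_apply D z) = blinfun_apply D (blinfun_apply (adj C) z)" for z
    by (metis comm blinfun_apply_blinfun_compose)
  have "cinner (blinfun_apply (op_power ?S (Suc n)) x) y
      = cinner (blinfun_apply D (blinfun_apply (op_power ?S n) x)) (blinfun_apply C y)"
    by (simp add: op_power_Suc cinner_adj'[OF C])
  also have "blinfun_apply D (blinfun_apply (op_power ?S n) x) = blinfun_apply (op_power ?S n) (blinfun_apply D x)"
    by (rule op_power_commute[symmetric]) (simp add: DC)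
  also have "cinner \<dots> (blinfun_apply C y)
      = cinner (blinfun_apply (op_power D n) (blinfun_apply D x)) (blinfun_apply (op_power C n) (blinfun_apply C y))"
    by (rule Suc)
  finally show ?case by (simp add: op_power_apply funpow_swap1)
qed simp

subsection \<open>The diagonal of a power series of \<open>A\<^sup>* A\<close>\<close>

text \<open>Each term is a weight times a squared norm. This is what allows complex traces to be
  treated as sums of nonnegative reals.\<close>

lemma normal_op_series_diagonal:
  fixes C :: "'a :: chilbert_space \<Rightarrow>\<^sub>L 'a"
  assumes C: "normal_op C" and r: "(norm C)\<^sup>2 \<le> r" and sm: "summable (\<lambda>n. cmod (\<alpha> n) * r ^ n)"
  defines "T \<equiv> op_series (\<lambda>n. complex_of_real (cmod (\<alpha> n))) (adj C o\<^sub>L C)"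
  shows "(\<lambda>n. cmod (\<alpha> n) * (norm (blinfun_apply (op_power C n) x))\<^sup>2) sums Re (cinner (blinfun_apply T x) x)"
    and "0 \<le> Re (cinner (blinfun_apply T x) x)"
    and "cinner (blinfun_apply T x) x = complex_of_real (Re (cinner (blinfun_apply T x) x))"
proof -
  have bC: "C \<in> bounded_ops" and comm: "adj C o\<^sub>L C = C o\<^sub>L adj C" using C by (auto simp: normal_op_def)
  have nS: "norm (adj C o\<^sub>L C) \<le> r"
    using norm_blinfun_compose[of "adj C" C] r bC by (simp add: power2_eq_square)
  let ?f = "\<lambda>n. cmod (\<alpha> n) * (norm (blinfun_apply (op_power C n) x))\<^sup>2"
  have cs: "(\<lambda>n. complex_of_real (?f n)) sums cinner (blinfun_apply T x) x"
    using cinner_op_series_sums[OF nS, of "\<lambda>n. complex_of_real (cmod (\<alpha> n))" x x] sm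
    unfolding cinner_op_power_adj_compose[OF bC comm] by (simp add: T_def cinner_self)
  then show s: "?f sums Re (cinner (blinfun_apply T x) x)"
    using sums_Re[OF cs] by simp
  then show "0 \<le> Re (cinner (blinfun_apply T x) x)"
    using sums_le[OF _ sums_zero s] by simp
  show "cinner (blinfun_apply T x) x = complex_of_real (Re (cinner (blinfun_apply T x) x))"
    using cs sums_of_real[OF s, where 'a = complex] sums_unique2 by blast
qed

lemma normal_op_series_diagonal_summable:
  fixes C :: "'a :: chilbert_space \<Rightarrow>\<^sub>L 'a"
  assumes C: "normal_op C" "C \<in> hilbert_schmidt" and E: "is_onb E"
    and r: "(\<Sum>\<^sub>\<infinity>e\<in>E. (norm (blinfun_apply C e))\<^sup>2) \<le> r"
    and sm: "summable (\<lambda>n. cmod (\<alpha> n) * r ^ n)"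
    and or: "\<alpha> 0 = 0 \<or> finite E"
  defines "T \<equiv> op_series (\<lambda>n. complex_of_real (cmod (\<alpha> n))) (adj C o\<^sub>L C)"
  shows "(\<lambda>e. Re (cinner (blinfun_apply T e) e)) summable_on E"
proof (cases "finite E")
  case False
  then have 0: "\<alpha> 0 = 0" using or by blast
  have nC: "(norm C)\<^sup>2 \<le> r" using norm_le_hilbert_schmidt[OF C(2) E] r by linarith
  then have r0: "r \<ge> 0" using zero_le_power2 order_trans by blast
  note diag = normal_op_series_diagonal[OF C(1) nC sm, folded T_def]
  have "(\<Sum>e\<in>F. Re (cinner (blinfun_apply T e) e)) \<le> (\<Sum>n. cmod (\<alpha> n) * r ^ n)" if F: "finite F" "F \<subseteq> E" for F
  proof (rule sums_le)
    show "(\<lambda>n. \<Sum>e\<in>F. cmod (\<alpha> n) * (norm (blinfun_apply (op_power C n) e))\<^sup>2) sums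
        (\<Sum>e\<in>F. Re (cinner (blinfun_apply T e) e))"
      by (rule sums_sum) (rule diag(1))
    show "(\<lambda>n. cmod (\<alpha> n) * r ^ n) sums (\<Sum>n. cmod (\<alpha> n) * r ^ n)" by (rule summable_sums[OF sm])
    fix n
    \<comment> \<open>The estimate spends one factor C on the sum over the basis. At n = 0 there is
      none and the sum would count F, but there the coefficient vanishes.\<close>
    show "(\<Sum>e\<in>F. cmod (\<alpha> n) * (norm (blinfun_apply (op_power C n) e))\<^sup>2) \<le> cmod (\<alpha> n) * r ^ n"
    proof (cases n)
      case (Suc m)
      \<comment> \<open>Only the innermost factor keeps its dependence on e; the other m = n - 1
        factors are estimated by the operator norm.\<close>
      have "(norm (blinfun_apply (op_power C n) e))\<^sup>2 \<le> r ^ m * (norm (blinfun_apply C e))\<^sup>2" for e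
      proof -
        have "norm (blinfun_apply (op_power C n) e) = norm (blinfun_apply (op_power C m) (blinfun_apply C e))"
          by (simp add: Suc op_power_apply funpow_swap1)
        also have "\<dots> \<le> norm C ^ m * norm (blinfun_apply C e)" by (rule norm_op_power_apply_le)
        finally have "(norm (blinfun_apply (op_power C n) e))\<^sup>2 \<le> (norm C ^ m * norm (blinfun_apply C e))\<^sup>2"
          by (intro power_mono) auto
        also have "\<dots> = ((norm C)\<^sup>2) ^ m * (norm (blinfun_apply C e))\<^sup>2"
          by (simp add: power_mult_distrib flip: power_mult) (simp add: mult.commute)
        also have "\<dots> \<le> r ^ m * (norm (blinfun_apply C e))\<^sup>2"
          using nC by (intro mult_right_mono power_mono) auto
        finally show ?thesis .
      qed
      then have "(\<Sum>e\<in>F. (norm (blinfun_apply (op_power C n) e))\<^sup>2) \<le> r ^ m * (\<Sum>e\<in>F. (norm (blinfun_apply C e))\<^sup>2)"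
        unfolding sum_distrib_left by (intro sum_mono)
      also have "\<dots> \<le> r ^ m * (\<Sum>\<^sub>\<infinity>e\<in>E. (norm (blinfun_apply C e))\<^sup>2)"
        using r0 by (intro mult_left_mono finite_sum_le_infsum hilbert_schmidt_summable C E F) auto
      also have "r ^ m * (\<Sum>\<^sub>\<infinity>e\<in>E. (norm (blinfun_apply C e))\<^sup>2) \<le> r ^ m * r"
        using r r0 by (intro mult_left_mono) auto
      finally have "(\<Sum>e\<in>F. (norm (blinfun_apply (op_power C n) e))\<^sup>2) \<le> r ^ n"
        by (simp add: Suc mult.commute)
      then show ?thesis by (simp add: mult_left_mono flip: sum_distrib_left)
    qed (simp add: 0)
  qed
  then show ?thesis using diag(2)
    by (intro nonneg_bdd_above_summable_on bdd_aboveI2[where M = "\<Sum>n. cmod (\<alpha> n) * r ^ n"]) auto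
qed (rule summable_on_finite)

section \<open>The common radius, the constant term and the final inequality\<close>

lemma radius_dominating:
  fixes \<alpha> :: "nat \<Rightarrow> complex" and R :: ereal and a b :: real
  assumes R: "0 < R" "ereal a < R" "ereal b < R"
    and sm: "\<And>z. z \<in> open_disc R \<Longrightarrow> summable (\<lambda>n. \<alpha> n * z ^ n)"
  obtains r where "r > 0" "a \<le> r" "b \<le> r" "summable (\<lambda>n. cmod (\<alpha> n) * r ^ n)"
proof -
  \<comment> \<open>Including 0 makes r positive, as the factorisation of the series
    requires.\<close>
  define m where "m = max (max a b) 0"
  have "ereal m < R" using R by (auto simp: m_def max_def zero_ereal_def)
  then obtain r where r: "m < r" "ereal r < R" using ereal_dense2[of "ereal m" R] by auto
  \<comment> \<open>Convergence at t yields absolute convergence only at strictly smaller moduli, so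
    r is kept below a second point of the disc.\<close>
  then obtain t where t: "r < t" "ereal t < R" using ereal_dense2[of "ereal r" R] by auto
  have m: "m \<ge> 0" "a \<le> m" "b \<le> m" by (auto simp: m_def)
  then have "complex_of_real t \<in> open_disc R" using r t by (simp add: open_disc_def)
  then have "summable (\<lambda>n. norm (\<alpha> n * complex_of_real r ^ n))"
    by (rule powser_insidea[OF sm]) (use r t m in auto)
  then have "summable (\<lambda>n. cmod (\<alpha> n) * r ^ n)"
    using r m by (simp add: norm_mult norm_power)
  then show ?thesis using that[of r] r m by simp
qed

lemma op_power_abs_op_2:
  fixes A :: "'a :: chilbert_space \<Rightarrow>\<^sub>L 'a"
  assumes "A \<in> bounded_ops"
  shows "op_power (abs_op A) 2 = adj A o\<^sub>L A"
proof -
  have "op_power (abs_op A) 2 = abs_op A o\<^sub>L abs_op A"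
    by (rule blinfun_eqI) (simp add: op_power_Suc numeral_2_eq_2)
  then show ?thesis by (simp add: abs_op(2)[OF assms])
qed

lemma Re_infsum_complex_of_real:
  "f summable_on E \<Longrightarrow> Re (\<Sum>\<^sub>\<infinity>e\<in>E. complex_of_real (f e)) = infsum f E"
  using infsum_Re[OF summable_on_of_real, of f E] by simp

text \<open>Summability is not assumed: a divergent family has sum 0 by convention. This serves the
  case of a nonzero constant term.\<close>

lemma Re_infsum_complex_of_real_nonneg:
  assumes "\<And>e. 0 \<le> f e"
  shows "0 \<le> Re (\<Sum>\<^sub>\<infinity>e\<in>E. complex_of_real (f e))"
proof (cases "(\<lambda>e. complex_of_real (f e)) summable_on E")
  case True
  then show ?thesis by (simp flip: infsum_Re add: infsum_nonneg assms)
qed (simp add: infsum_not_exists)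

text \<open>
  If the power series has a nonzero constant term and the space is infinite-dimensional, the series
  is not trace class, the diagonal is not summable, and \<open>tr\<close> takes its junk value \<open>0\<close>.
\<close>

lemma infsum_add_const_eq_0:
  fixes w :: "'i \<Rightarrow> complex"
  assumes w: "w summable_on E" and "infinite E" and "c \<noteq> 0"
  shows "(\<Sum>\<^sub>\<infinity>e\<in>E. c + w e) = 0"
proof (rule infsum_not_exists)
  show "\<not> (\<lambda>e. c + w e) summable_on E"
  proof
    assume "(\<lambda>e. c + w e) summable_on E"
    then have "(\<lambda>e. c + w e + (- w e)) summable_on E"
      by (rule summable_on_add) (use w in \<open>simp add: summable_on_uminus\<close>)
    then have "(\<lambda>e. c) summable_on E" by simp
    then have "(\<lambda>e. norm c) summable_on E"
      unfolding summable_on_iff_abs_summable_on_complex[of "\<lambda>_. c"] .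
    then show False
      using infsum_diverge_constant[OF \<open>infinite E\<close>, of "norm c"] \<open>c \<noteq> 0\<close> by simp
  qed
qed

text \<open>The weight |\<alpha> n| is put once into each of the two factors, so the squared n-th
  term is bounded by the product of the n-th terms of the two diagonal series.\<close>

lemma cinner_op_series_square_le:
  fixes A B :: "'a :: chilbert_space \<Rightarrow>\<^sub>L 'a"
  assumes A: "normal_op A" "(norm A)\<^sup>2 \<le> r" and B: "normal_op B" "(norm B)\<^sup>2 \<le> r"
    and comm: "adj A o\<^sub>L B = B o\<^sub>L adj A"
    and sm: "summable (\<lambda>n. cmod (\<alpha> n) * r ^ n)"
  defines "\<alpha>\<^sub>a \<equiv> \<lambda>n. complex_of_real (cmod (\<alpha> n))"
  shows "norm (adj A o\<^sub>L B) \<le> r"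
    and "(cmod (cinner (blinfun_apply (op_series \<alpha> (adj A o\<^sub>L B)) x) x))\<^sup>2
      \<le> Re (cinner (blinfun_apply (op_series \<alpha>\<^sub>a (adj A o\<^sub>L A)) x) x)
        * Re (cinner (blinfun_apply (op_series \<alpha>\<^sub>a (adj B o\<^sub>L B)) x) x)"
proof -
  have bA: "A \<in> bounded_ops" using A by (simp add: normal_op_def)
  have "norm (adj A o\<^sub>L B) \<le> norm A * norm B"
    using norm_blinfun_compose[of "adj A" B] bA by simp
  \<comment> \<open>Arithmetic-geometric mean: the product is at most half the sum of the squares,
    each of which is at most r.\<close>
  also have "\<dots> \<le> r"
    using sum_squares_bound[of "norm A" "norm B", unfolded mult.assoc] A(2) B(2) by linarith
  finally show nS: "norm (adj A o\<^sub>L B) \<le> r" .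
  show "(cmod (cinner (blinfun_apply (op_series \<alpha> (adj A o\<^sub>L B)) x) x))\<^sup>2
      \<le> Re (cinner (blinfun_apply (op_series \<alpha>\<^sub>a (adj A o\<^sub>L A)) x) x)
        * Re (cinner (blinfun_apply (op_series \<alpha>\<^sub>a (adj B o\<^sub>L B)) x) x)"
    unfolding \<alpha>\<^sub>a_def
  proof (rule norm_sums_square_le)
    let ?a = "\<lambda>n. norm (blinfun_apply (op_power A n) x)" and ?b = "\<lambda>n. norm (blinfun_apply (op_power B n) x)"
    show "(\<lambda>n. \<alpha> n * cinner (blinfun_apply (op_power B n) x) (blinfun_apply (op_power A n) x))
        sums cinner (blinfun_apply (op_series \<alpha> (adj A o\<^sub>L B)) x) x"
      using cinner_op_series_sums[OF nS sm, of x x] by (simp add: cinner_op_power_adj_compose[OF bA comm])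
    show "(\<lambda>n. cmod (\<alpha> n) * (?a n)\<^sup>2) sums
        Re (cinner (blinfun_apply (op_series (\<lambda>n. complex_of_real (cmod (\<alpha> n))) (adj A o\<^sub>L A)) x) x)"
      by (rule normal_op_series_diagonal(1)[OF A sm])
    show "(\<lambda>n. cmod (\<alpha> n) * (?b n)\<^sup>2) sums
        Re (cinner (blinfun_apply (op_series (\<lambda>n. complex_of_real (cmod (\<alpha> n))) (adj B o\<^sub>L B)) x) x)"
      by (rule normal_op_series_diagonal(1)[OF B sm])
    fix n
    have "cmod (cinner (blinfun_apply (op_power B n) x) (blinfun_apply (op_power A n) x)) \<le> ?a n * ?b n"
      using norm_cinner_le by (metis mult.commute)
    then have "(cmod (\<alpha> n * cinner (blinfun_apply (op_power B n) x) (blinfun_apply (op_power A n) x)))\<^sup>2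
        \<le> (cmod (\<alpha> n) * (?a n * ?b n))\<^sup>2"
      unfolding norm_mult by (intro power_mono mult_left_mono) auto
    then show "(cmod (\<alpha> n * cinner (blinfun_apply (op_power B n) x) (blinfun_apply (op_power A n) x)))\<^sup>2
        \<le> (cmod (\<alpha> n) * (?a n)\<^sup>2) * (cmod (\<alpha> n) * (?b n)\<^sup>2)"
      by (simp add: power2_eq_square mult_ac)
  qed simp_all
qed

text \<open>Isolates the constant term; what remains has a summable diagonal even in infinite
  dimension.\<close>

lemma cinner_op_series_split:
  fixes S :: "'a :: chilbert_space \<Rightarrow>\<^sub>L 'a"
  assumes S: "norm S \<le> r" and sm: "summable (\<lambda>n. cmod (\<alpha> n) * r ^ n)"
  shows "summable (\<lambda>n. cmod ((\<alpha>(0 := 0)) n) * r ^ n)"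
    and "cinner (blinfun_apply (op_series \<alpha> S) x) y
      = \<alpha> 0 * cinner x y + cinner (blinfun_apply (op_series (\<alpha>(0 := 0)) S) x) y"
proof -
  have r: "r \<ge> 0" using S norm_ge_zero order_trans by blast
  show sm': "summable (\<lambda>n. cmod ((\<alpha>(0 := 0)) n) * r ^ n)"
    by (rule summable_comparison_test'[OF sm]) (use r in auto)
  let ?h = "\<lambda>n. cinner (blinfun_apply (op_power S n) x) y"
  have "(\<lambda>n. if n = 0 then \<alpha> 0 * cinner x y else 0) sums (\<alpha> 0 * cinner x y)"
    by (rule sums_single)
  then have "(\<lambda>n. (if n = 0 then \<alpha> 0 * cinner x y else 0) + (\<alpha>(0 := 0)) n * ?h n)
      sums (\<alpha> 0 * cinner x y + cinner (blinfun_apply (op_series (\<alpha>(0 := 0)) S) x) y)"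
    by (rule sums_add) (rule cinner_op_series_sums[OF S sm'])
  moreover have "(\<lambda>n. (if n = 0 then \<alpha> 0 * cinner x y else 0) + (\<alpha>(0 := 0)) n * ?h n) = (\<lambda>n. \<alpha> n * ?h n)"
    by (rule ext) simp
  ultimately show "cinner (blinfun_apply (op_series \<alpha> S) x) y
      = \<alpha> 0 * cinner x y + cinner (blinfun_apply (op_series (\<alpha>(0 := 0)) S) x) y"
    using sums_unique2[OF cinner_op_series_sums[OF S sm, of x y]] by simp
qed

text \<open>The right-hand traces are sums of real diagonal entries, so \<open>Re\<close> loses
  nothing. Membership in \<open>trace_class\<close> carries a condition because a nonzero multiple
  of the identity is not trace class in infinite dimension; the inequality stands outside it and
  also covers the default value of \<open>tr\<close>.\<close>

theorem theorem6:
  fixes \<alpha> :: "nat \<Rightarrow> complex" and R :: ereal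
    and A B :: "'a :: chilbert_space \<Rightarrow>\<^sub>L 'a"
  assumes "0 < R"
    and "\<And>z. z \<in> open_disc R \<Longrightarrow> summable (\<lambda>n. \<alpha> n * z ^ n)"
    and "A \<in> hilbert_schmidt" and "B \<in> hilbert_schmidt"
    and "normal_op A" and "normal_op B"
    and "adj A o\<^sub>L B = B o\<^sub>L adj A"
    and "ereal (Re (tr (op_power (abs_op A) 2))) < R"
    and "ereal (Re (tr (op_power (abs_op B) 2))) < R"
  defines "\<alpha>\<^sub>a \<equiv> \<lambda>n. complex_of_real (cmod (\<alpha> n))"
  shows "(\<alpha> 0 = 0 \<or> finite_dim TYPE('a) \<longrightarrow>
            op_series \<alpha> (adj A o\<^sub>L B) \<in> trace_class \<and>
            op_series \<alpha>\<^sub>a (op_power (abs_op A) 2) \<in> trace_class \<and>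
            op_series \<alpha>\<^sub>a (op_power (abs_op B) 2) \<in> trace_class) \<and>
         (cmod (tr (op_series \<alpha> (adj A o\<^sub>L B))))\<^sup>2
           \<le> Re (tr (op_series \<alpha>\<^sub>a (op_power (abs_op A) 2))) *
             Re (tr (op_series \<alpha>\<^sub>a (op_power (abs_op B) 2)))"
proof -
  note HS = assms(3,4) and nrm = assms(5,6) and comm = assms(7)
  have bd: "A \<in> bounded_ops" "B \<in> bounded_ops" using HS by (simp_all add: hilbert_schmidt_bounded)
  \<comment> \<open>Naming the basis selected by \<open>tr\<close> turns every trace below into a
    sum over the same set.\<close>
  define E where "E = (SOME E :: 'a set. is_onb E)"
  have E: "is_onb E" unfolding E_def by (rule someI_ex[OF onb_exists])
  have tr: "tr T = (\<Sum>\<^sub>\<infinity>e\<in>E. cinner (blinfun_apply T e) e)" for T :: "'a \<Rightarrow>\<^sub>L 'a"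
    by (simp add: tr_def E_def)
  \<comment> \<open>Converts the hypotheses on traces into bounds on Hilbert-Schmidt sums, and
    thereby on operator norms.\<close>
  have tr_square: "Re (tr (op_power (abs_op C) 2)) = (\<Sum>\<^sub>\<infinity>e\<in>E. (norm (blinfun_apply C e))\<^sup>2)"
    if "C \<in> hilbert_schmidt" for C :: "'a \<Rightarrow>\<^sub>L 'a"
    unfolding op_power_abs_op_2[OF hilbert_schmidt_bounded[OF that]] tr
      cinner_adj_compose_self[OF hilbert_schmidt_bounded[OF that]]
    by (rule Re_infsum_complex_of_real[OF hilbert_schmidt_summable[OF that E]])
  obtain r where r: "r > 0" "Re (tr (op_power (abs_op A) 2)) \<le> r" "Re (tr (op_power (abs_op B) 2)) \<le> r"
    and sm: "summable (\<lambda>n. cmod (\<alpha> n) * r ^ n)"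
    using radius_dominating[OF assms(1,8,9,2)] by metis
  note rA = r(2)[unfolded tr_square[OF HS(1)]] and rB = r(3)[unfolded tr_square[OF HS(2)]]
  have nA: "(norm A)\<^sup>2 \<le> r" using norm_le_hilbert_schmidt[OF HS(1) E] rA by linarith
  have nB: "(norm B)\<^sup>2 \<le> r" using norm_le_hilbert_schmidt[OF HS(2) E] rB by linarith
  have commA: "adj A o\<^sub>L A = A o\<^sub>L adj A" and commB: "adj B o\<^sub>L B = B o\<^sub>L adj B"
    using nrm by (simp_all add: normal_op_def)
  have nAA: "norm (adj A o\<^sub>L A) \<le> r" and nBB: "norm (adj B o\<^sub>L B) \<le> r" and nAB: "norm (adj A o\<^sub>L B) \<le> r"
    by (rule cinner_op_series_square_le(1)[OF nrm(1) nA nrm(1) nA commA sm]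
        cinner_op_series_square_le(1)[OF nrm(2) nB nrm(2) nB commB sm]
        cinner_op_series_square_le(1)[OF nrm(1) nA nrm(2) nB comm sm])+
  have sma: "summable (\<lambda>n. cmod (\<alpha>\<^sub>a n) * r ^ n)" using sm by (simp add: \<alpha>\<^sub>a_def)
  define u where "u = (\<lambda>e. Re (cinner (blinfun_apply (op_series \<alpha>\<^sub>a (adj A o\<^sub>L A)) e) e))"
  define v where "v = (\<lambda>e. Re (cinner (blinfun_apply (op_series \<alpha>\<^sub>a (adj B o\<^sub>L B)) e) e))"
  have u0: "0 \<le> u e" and v0: "0 \<le> v e" for e
    unfolding u_def v_def \<alpha>\<^sub>a_def
    by (rule normal_op_series_diagonal(2)[OF nrm(1) nA sm] normal_op_series_diagonal(2)[OF nrm(2) nB sm])+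
  have trA: "tr (op_series \<alpha>\<^sub>a (op_power (abs_op A) 2)) = (\<Sum>\<^sub>\<infinity>e\<in>E. complex_of_real (u e))"
    unfolding op_power_abs_op_2[OF bd(1)] tr u_def \<alpha>\<^sub>a_def
    by (rule infsum_cong) (rule normal_op_series_diagonal(3)[OF nrm(1) nA sm])
  have trB: "tr (op_series \<alpha>\<^sub>a (op_power (abs_op B) 2)) = (\<Sum>\<^sub>\<infinity>e\<in>E. complex_of_real (v e))"
    unfolding op_power_abs_op_2[OF bd(2)] tr v_def \<alpha>\<^sub>a_def
    by (rule infsum_cong) (rule normal_op_series_diagonal(3)[OF nrm(2) nB sm])
  have trace_classes: "op_series \<alpha> (adj A o\<^sub>L B) \<in> trace_class \<and>
            op_series \<alpha>\<^sub>a (op_power (abs_op A) 2) \<in> trace_class \<and>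
            op_series \<alpha>\<^sub>a (op_power (abs_op B) 2) \<in> trace_class"
    if or: "\<alpha> 0 = 0 \<or> finite_dim TYPE('a)"
  proof -
    have ora: "\<alpha>\<^sub>a 0 = 0 \<or> finite_dim TYPE('a)" using or by (simp add: \<alpha>\<^sub>a_def)
    show ?thesis
      unfolding op_power_abs_op_2[OF bd(1)] op_power_abs_op_2[OF bd(2)]
      by (intro conjI op_series_trace_class[OF HS(1) HS(2) r(1) nAB sm or]
          op_series_trace_class[OF HS(1) HS(1) r(1) nAA sma ora]
          op_series_trace_class[OF HS(2) HS(2) r(1) nBB sma ora])
  qed
  \<comment> \<open>The split is by \<open>finite E\<close> rather than \<open>finite_dim\<close>,
    since what matters is summability over this basis.\<close>
  have "(cmod (tr (op_series \<alpha> (adj A o\<^sub>L B))))\<^sup>2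
      \<le> Re (\<Sum>\<^sub>\<infinity>e\<in>E. complex_of_real (u e)) * Re (\<Sum>\<^sub>\<infinity>e\<in>E. complex_of_real (v e))"
  proof (cases "\<alpha> 0 = 0 \<or> finite E")
    case True
    have su: "u summable_on E" and sv: "v summable_on E"
      unfolding u_def v_def \<alpha>\<^sub>a_def
      by (rule normal_op_series_diagonal_summable[OF nrm(1) HS(1) E rA sm True]
          normal_op_series_diagonal_summable[OF nrm(2) HS(2) E rB sm True])+
    show ?thesis
      unfolding Re_infsum_complex_of_real[OF su] Re_infsum_complex_of_real[OF sv] tr
    proof (rule norm_infsum_square_le(2)[OF su sv _ u0 v0])
      fix e
      show "(cmod (cinner (blinfun_apply (op_series \<alpha> (adj A o\<^sub>L B)) e) e))\<^sup>2 \<le> u e * v e"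
        unfolding u_def v_def \<alpha>\<^sub>a_def by (rule cinner_op_series_square_le(2)[OF nrm(1) nA nrm(2) nB comm sm])
    qed
  next
    case False
    \<comment> \<open>Here every diagonal entry on the left is the nonzero constant
      \<open>\<alpha> 0\<close> plus a summable remainder, so the left-hand side takes the default
      value 0; it remains that both factors on the right are nonnegative.\<close>
    let ?\<beta> = "\<alpha>(0 := 0)"
    define w where "w = (\<lambda>e. cinner (blinfun_apply (op_series ?\<beta> (adj A o\<^sub>L B)) e) e)"
    note smb = cinner_op_series_split(1)[OF nAB sm]
    have b0: "?\<beta> 0 = 0 \<or> finite E" by simp
    \<comment> \<open>With the constant term removed, Cauchy-Schwarz dominates w by two summable
      diagonals.\<close>
    have "w summable_on E"
      unfolding w_def
      by (rule norm_infsum_square_le(1)[OF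
            normal_op_series_diagonal_summable[OF nrm(1) HS(1) E rA smb b0]
            normal_op_series_diagonal_summable[OF nrm(2) HS(2) E rB smb b0]
            cinner_op_series_square_le(2)[OF nrm(1) nA nrm(2) nB comm smb]
            normal_op_series_diagonal(2)[OF nrm(1) nA smb]
            normal_op_series_diagonal(2)[OF nrm(2) nB smb]])
    then have "(\<Sum>\<^sub>\<infinity>e\<in>E. \<alpha> 0 + w e) = 0" using False by (intro infsum_add_const_eq_0) auto
    moreover have "tr (op_series \<alpha> (adj A o\<^sub>L B)) = (\<Sum>\<^sub>\<infinity>e\<in>E. \<alpha> 0 + w e)"
      unfolding tr
    proof (rule infsum_cong)
      fix e assume "e \<in> E"
      then have "cinner e e = 1" using E by (simp add: is_onb_def cinner_self)
      then show "cinner (blinfun_apply (op_series \<alpha> (adj A o\<^sub>L B)) e) e = \<alpha> 0 + w e"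
        using cinner_op_series_split(2)[OF nAB sm, of e e] by (simp add: w_def)
    qed
    ultimately show ?thesis
      using Re_infsum_complex_of_real_nonneg[of u E] Re_infsum_complex_of_real_nonneg[of v E] u0 v0
      by (simp add: mult_nonneg_nonneg)
  qed
  then show ?thesis using trace_classes unfolding trA trB by blast
qed

end
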